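(* Let $\delta\in(0,1)$, $\epsilon\in(0,1)$, and suppose $X\sim(1-\epsilon)\Delta_0+\epsilon\Delta_\mu$, where $\mu$ is a non-zero constant. For any $0\le p<1$ there exists a threshold $\tilde\sigma_w$ such that for all $\sigma_w>\tilde\sigma_w$ optimal-$\lambda$ $\ell_1$-AMP outperforms the lowest fixed point of optimal-$\lambda$ $\ell_p$-AMP; that is, the fixed point of $\Psi_{\lambda_*,1}$ is strictly smaller than the lowest fixed point of $\Psi_{\lambda_*,p}$.
   Context: $\Delta_a$ denotes the point mass at $a$. For $0\le p\le1$, $\lambda\ge0$, $u\in\mathbb{R}$: $\eta_p(u;\lambda)=\arg\min_{x\in\mathbb{R}}\frac12(u-x)^2+\lambda|x|^p$ (with $|x|^0=\mathbb{I}(x\neq0)$), the value $0$ being chosen when the minimizer is not unique. State evolution map with optimal thresholding policy, for noise level $\sigma_w$ and $\sigma\ge0$: $$\Psi_{\lambda_*,p}(\sigma^2)=\sigma_w^2+\frac1\delta\inf_{\lambda\ge0}\mathbb{E}\left|\eta_p(X+\sigma Z;\lambda)-X\right|^2,$$ with $X$ and $Z\sim N(0,1)$ independent. A fixed point is $\sigma\ge0$ with $\Psi_{\lambda_*,p}(\sigma^2)=\sigma^2$; the lowest fixed point is the smallest such $\sigma$. The performance (asymptotic mean square error) of optimal-$\lambda$ $\ell_p$-AMP at a fixed point $\sigma$ is $\delta(\sigma^2-\sigma_w^2)$, so a lower fixed point means better performance. $\Psi_{\lambda_*,1}$ has a unique stable fixed point. *)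

theory Defs
  imports "HOL-Probability.Probability"
begin

text \<open>Since \<open>0 powr a = 0\<close> for every \<open>a\<close> (including \<open>a = 0\<close>) and \<open>y powr 0 = 1\<close> for \<open>y \<noteq> 0\<close>,
  the penalty \<open>\<bar>x\<bar> powr p\<close> is the indicator of \<open>x \<noteq> 0\<close> when \<open>p = 0\<close>.\<close>

definition lp_objective :: "real \<Rightarrow> real \<Rightarrow> real \<Rightarrow> real \<Rightarrow> real" where
  "lp_objective p u l x = (u - x)\<^sup>2 / 2 + l * \<bar>x\<bar> powr p"

text \<open>A minimizer always exists for \<open>l \<ge> 0\<close> and \<open>0 \<le> p \<le> 1\<close>, so the second branch is
  exactly the case of several minimizers.\<close>

definition lp_prox :: "real \<Rightarrow> real \<Rightarrow> real \<Rightarrow> real" where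
  "lp_prox p u l =
     (if \<exists>!x. is_arg_min (lp_objective p u l) (\<lambda>_. True) x
      then THE x. is_arg_min (lp_objective p u l) (\<lambda>_. True) x
      else 0)"

text \<open>The state evolution map takes the variance \<open>s = \<sigma>\<^sup>2\<close> as its argument.
  The infimum is over a nonempty set of nonnegative reals.\<close>

definition state_evolution ::
  "'a measure \<Rightarrow> ('a \<Rightarrow> real) \<Rightarrow> ('a \<Rightarrow> real) \<Rightarrow> real \<Rightarrow> real \<Rightarrow> real \<Rightarrow> real \<Rightarrow> real" where
  "state_evolution M X Z \<delta> \<sigma>w p s =
     \<sigma>w\<^sup>2 + 1 / \<delta> *
       (INF l\<in>{0..}. \<integral>\<omega>. \<bar>lp_prox p (X \<omega> + sqrt s * Z \<omega>) l - X \<omega>\<bar>\<^sup>2 \<partial>M)"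

definition fixed_point :: "(real \<Rightarrow> real) \<Rightarrow> real \<Rightarrow> bool" where
  "fixed_point \<Psi> \<sigma> \<longleftrightarrow> 0 \<le> \<sigma> \<and> \<Psi> (\<sigma>\<^sup>2) = \<sigma>\<^sup>2"

definition lowest_fixed_point :: "(real \<Rightarrow> real) \<Rightarrow> real \<Rightarrow> bool" where
  "lowest_fixed_point \<Psi> \<sigma> \<longleftrightarrow> fixed_point \<Psi> \<sigma> \<and> (\<forall>\<tau>. fixed_point \<Psi> \<tau> \<longrightarrow> \<sigma> \<le> \<tau>)"

end

theory Submission
  imports Defs
begin

text \<open>Let \<open>R\<^sub>p(\<sigma>)\<close> be the optimally tuned risk at noise level \<open>\<sigma>\<close>; the trivial estimator \<open>0\<close> has risk
  \<open>\<epsilon>\<mu>\<^sup>2\<close>. For \<open>p < 1\<close> the thresholding function jumps from \<open>0\<close> to at least a fixed fraction of its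
  argument, and for large \<open>\<sigma>\<close> this makes it no better than \<open>0\<close>: \<open>R\<^sub>p(\<sigma>) = \<epsilon>\<mu>\<^sup>2\<close>. Soft thresholding of
  \<open>X/\<sigma> + Z\<close>, however, at a threshold of order \<open>\<sigma>/\<bar>\<mu>\<bar>\<close> in units of \<open>\<sigma>\<close> has an exponentially small but
  strict gain, so \<open>R\<^sub>1(\<sigma>) < \<epsilon>\<mu>\<^sup>2\<close>. All fixed points are at least \<open>\<sigma>\<^sub>w\<close>, so for large \<open>\<sigma>\<^sub>w\<close> the map for \<open>p = 1\<close>
  lies strictly below the diagonal at the lowest fixed point for \<open>p\<close>, which puts its own lowest fixed
  point strictly to the left. This fixed point is the only one because \<open>R\<^sub>1(\<sigma>)/\<sigma>\<^sup>2\<close> is nonincreasing;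
  lowest fixed points exist because \<open>\<sigma> R\<^sub>p(\<sigma>)\<close> is nondecreasing.\<close>

subsection \<open>Minimizers of the penalized objective\<close>

definition lp_minimizer :: "real \<Rightarrow> real \<Rightarrow> real \<Rightarrow> real \<Rightarrow> bool" where
  "lp_minimizer p l u x \<longleftrightarrow> (\<forall>y. lp_objective p u l x \<le> lp_objective p u l y)"

text \<open>For \<open>l > 0\<close> and \<open>p < 1\<close> the thresholding function jumps at
  some \<open>u > 0\<close> from \<open>0\<close> to \<open>x\<close> with
  \<open>x powr (2 - p) = 2 * l * (1 - p)\<close>; this is the quotient \<open>x / u\<close>,
  independent of \<open>l\<close>.\<close>

definition jump_ratio :: "real \<Rightarrow> real" where
  "jump_ratio p = 2 * (1 - p) / (2 - p)"

lemma is_arg_min_lp_objective: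
  "is_arg_min (lp_objective p u l) (\<lambda>_. True) x \<longleftrightarrow> lp_minimizer p l u x"
  by (simp add: is_arg_min_linorder lp_minimizer_def)

lemma lp_objective_minus: "lp_objective p (- u) l (- x) = lp_objective p u l x"
  by (simp add: lp_objective_def power2_commute)

lemma lp_minimizer_minus_iff: "lp_minimizer p l (- u) (- x) \<longleftrightarrow> lp_minimizer p l u x"
  unfolding lp_minimizer_def by (metis lp_objective_minus add.inverse_inverse)

lemma lp_minimizer_same_sign:
  assumes "lp_minimizer p l u x"
  shows "0 \<le> u * x"
proof -
  have "lp_objective p u l x \<le> lp_objective p u l (- x)"
    using assms by (simp add: lp_minimizer_def)
  then show ?thesis
    by (simp add: lp_objective_def power2_eq_square algebra_simps)
qed

lemma lp_minimizer_abs_le: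
  assumes "lp_minimizer p l u x" "0 \<le> p" "0 \<le> l"
  shows "\<bar>x\<bar> \<le> \<bar>u\<bar>"
proof (rule ccontr)
  assume "\<not> ?thesis"
  then have lt: "\<bar>u\<bar> < \<bar>x\<bar>" by simp
  then have "l * \<bar>u\<bar> powr p \<le> l * \<bar>x\<bar> powr p"
    using assms by (intro mult_left_mono powr_mono2) auto
  moreover have "(u - x)\<^sup>2 / 2 + l * \<bar>x\<bar> powr p \<le> l * \<bar>u\<bar> powr p"
    using assms(1) by (auto simp: lp_minimizer_def lp_objective_def dest: spec[of _ u])
  ultimately have "(u - x)\<^sup>2 \<le> 0"
    by linarith
  with lt show False by simp
qed

lemma lp_minimizer_zero_iff:
  assumes "0 \<le> p" "0 \<le> l"
  shows "lp_minimizer p l 0 x \<longleftrightarrow> x = 0"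
proof
  show "lp_minimizer p l 0 x \<Longrightarrow> x = 0"
    using lp_minimizer_abs_le[OF _ assms] by fastforce
  show "x = 0 \<Longrightarrow> lp_minimizer p l 0 x"
    using assms by (simp add: lp_minimizer_def lp_objective_def)
qed

lemma lp_minimizer_penalty_le:
  assumes "lp_minimizer p l u x"
  shows "l * \<bar>x\<bar> powr p \<le> u * x - x\<^sup>2 / 2"
proof -
  have "lp_objective p u l x \<le> lp_objective p u l 0"
    using assms by (simp add: lp_minimizer_def)
  then show ?thesis
    by (simp add: lp_objective_def power2_eq_square field_simps)
qed

lemma lp_minimizer_stationary:
  assumes "lp_minimizer p l u x" "0 < x"
  shows "u - x = l * p * x powr (p - 1)"
proof -
  have "((\<lambda>y. (u - y)\<^sup>2 / 2 + l * y powr p) has_real_derivative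
      (x - u + l * (p * x powr (p - 1)))) (at x)"
    using assms(2) by (auto intro!: derivative_eq_intros)
  moreover have "\<forall>y. \<bar>x - y\<bar> < x \<longrightarrow>
      (u - x)\<^sup>2 / 2 + l * x powr p \<le> (u - y)\<^sup>2 / 2 + l * y powr p"
  proof (intro allI impI)
    fix y assume "\<bar>x - y\<bar> < x"
    then have "0 < y" by linarith
    then show "(u - x)\<^sup>2 / 2 + l * x powr p \<le> (u - y)\<^sup>2 / 2 + l * y powr p"
      using assms unfolding lp_minimizer_def lp_objective_def
      by (metis abs_of_pos)
  qed
  ultimately have "x - u + l * (p * x powr (p - 1)) = 0"
    using assms(2) by (intro DERIV_local_min[where d = x]) auto
  then show ?thesis by simp
qed

text \<open>Combine the stationarity condition with the comparison of the objective at \<open>x\<close> and \<open>0\<close>.\<close>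

lemma lp_minimizer_lower_bound_pos:
  assumes "lp_minimizer p l u x" "0 < x" "0 \<le> p" "p < 1"
  shows "jump_ratio p * u \<le> x"
proof -
  have "x * (u - x) = p * (l * x powr p)"
    using lp_minimizer_stationary[OF assms(1,2)] assms(2)
    by (simp add: powr_diff)
  also have "\<dots> \<le> p * (u * x - x\<^sup>2 / 2)"
    using lp_minimizer_penalty_le[OF assms(1)] assms(2,3) by (intro mult_left_mono) auto
  also have "\<dots> = x * (p * (u - x / 2))"
    by (simp add: power2_eq_square algebra_simps)
  finally have "u - x \<le> p * (u - x / 2)"
    using assms(2) by simp
  then have "2 * (1 - p) * u \<le> x * (2 - p)"
    by (simp add: algebra_simps)
  then show ?thesis
    using assms(4) by (simp add: jump_ratio_def divide_le_eq)
qed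

lemma lp_minimizer_lower_bound:
  assumes "lp_minimizer p l u x" "x \<noteq> 0" "0 \<le> p" "p < 1"
  shows "jump_ratio p * \<bar>u\<bar> \<le> \<bar>x\<bar>"
proof (cases "0 < x")
  case True
  then have "0 \<le> u"
    using lp_minimizer_same_sign[OF assms(1)] by (simp add: zero_le_mult_iff)
  with True show ?thesis
    using lp_minimizer_lower_bound_pos[OF assms(1) True assms(3,4)] by simp
next
  case False
  with assms(2) have neg: "0 < - x" by simp
  then have "u \<le> 0"
    using lp_minimizer_same_sign[OF assms(1)] by (auto simp: zero_le_mult_iff)
  with neg show ?thesis
    using lp_minimizer_lower_bound_pos[OF _ neg assms(3,4), of l "- u"] assms(1)
    by (simp add: lp_minimizer_minus_iff)
qed

lemma jump_ratio_pos: "p < 1 \<Longrightarrow> 0 < jump_ratio p"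
  by (simp add: jump_ratio_def)

text \<open>Two positive minimizers would, by the mean value theorem applied to the stationarity
  condition, enclose a point where the derivative of the penalty has slope \<open>-1\<close>; but the lower
  bound on minimizers makes that slope at least \<open>-p/2\<close>.\<close>

lemma lp_minimizer_unique_pos_aux:
  assumes x: "lp_minimizer p l u x" and y: "lp_minimizer p l u y"
    and "0 < x" "x < y" "0 \<le> p" "p < 1" "0 \<le> l"
  shows False
proof -
  define g where "g t = l * p * t powr (p - 1)" for t
  have der: "(g has_real_derivative (l * p * ((p - 1) * t powr (p - 2)))) (at t)"
    if "0 < t" for t
    unfolding g_def using that by (auto intro!: derivative_eq_intros)
  obtain t where t: "x < t" "t < y"
    and "g y - g x = (y - x) * (l * p * ((p - 1) * t powr (p - 2)))"
    using MVT2[of x y g "\<lambda>t. l * p * ((p - 1) * t powr (p - 2))"] der assms(3,4)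
    by (metis less_le_trans)
  moreover have "g y - g x = (y - x) * (- 1)"
    using lp_minimizer_stationary[OF x] lp_minimizer_stationary[OF y] assms(3,4)
    by (simp add: g_def)
  ultimately have "l * p * ((p - 1) * t powr (p - 2)) = - 1"
    using \<open>x < y\<close> by (metis mult_left_cancel diff_gt_0_iff_gt less_irrefl)
  then have "1 = (1 - p) * (l * p * t powr (p - 2))"
    by (simp add: algebra_simps)
  also have "\<dots> \<le> (1 - p) * (l * p * x powr (p - 2))"
    using assms t by (intro mult_left_mono powr_mono2') auto
  finally have "x \<le> (1 - p) * (l * p * (x powr (p - 2) * x))"
    using \<open>0 < x\<close> mult_right_mono[of 1 "(1 - p) * (l * p * x powr (p - 2))" x]
    by (simp add: algebra_simps)
  also have "x powr (p - 2) * x = x powr (p - 1)"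
    using \<open>0 < x\<close> powr_add[of x "p - 2" 1] by simp
  finally have "x \<le> (1 - p) * (u - x)"
    using lp_minimizer_stationary[OF x \<open>0 < x\<close>] by simp
  then have "2 * x \<le> 2 * (1 - p) * u - 2 * (1 - p) * x"
    by (simp add: algebra_simps)
  moreover have "2 * (1 - p) * u \<le> x * (2 - p)"
    using lp_minimizer_lower_bound_pos[OF x \<open>0 < x\<close> \<open>0 \<le> p\<close> \<open>p < 1\<close>] \<open>p < 1\<close>
    by (simp add: jump_ratio_def divide_le_eq)
  ultimately have "2 * x \<le> p * x"
    by (simp add: algebra_simps)
  then show False
    using \<open>0 < x\<close> \<open>p < 1\<close> by simp
qed

text \<open>Nonzero minimizers share the sign of \<open>u\<close>, so reflection reduces to the
  positive case. A tie can thus only be between \<open>0\<close> and one nonzero point.\<close>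

lemma lp_minimizer_unique_nonzero:
  assumes x: "lp_minimizer p l u x" and y: "lp_minimizer p l u y"
    and "x \<noteq> 0" "y \<noteq> 0" and p: "0 \<le> p" "p < 1" "0 \<le> l"
  shows "x = y"
proof -
  have pos: "x = y" if "lp_minimizer p l u x" "lp_minimizer p l u y" "0 < x" "0 < y" for u x y
    using lp_minimizer_unique_pos_aux[OF that(1,2) that(3) _ p]
      lp_minimizer_unique_pos_aux[OF that(2,1) that(4) _ p] by (metis linorder_neqE)
  have "0 \<le> u * x" "0 \<le> u * y" "u \<noteq> 0"
    using lp_minimizer_same_sign x y lp_minimizer_zero_iff assms by blast+
  then consider "0 < x" "0 < y" | "0 < - x" "0 < - y"
    using assms(3,4) by (auto simp: zero_le_mult_iff)
  then show ?thesis
    using pos[OF x y] pos[of "- u" "- x" "- y"] x y by cases (auto simp: lp_minimizer_minus_iff)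
qed

lemma lp_minimizer_exists:
  assumes "0 \<le> p" "0 \<le> l"
  shows "\<exists>x. lp_minimizer p l u x"
proof (cases "p = 0")
  case True
  show ?thesis
  proof (cases "l \<le> u\<^sup>2 / 2")
    case True
    then have "lp_minimizer p l u u"
      using \<open>p = 0\<close> assms by (auto simp: lp_minimizer_def lp_objective_def)
    then show ?thesis ..
  next
    case False
    have "lp_objective p u l 0 \<le> lp_objective p u l y" for y
    proof (cases "y = 0")
      case False
      then have "lp_objective p u l y = (u - y)\<^sup>2 / 2 + l"
        using \<open>p = 0\<close> by (simp add: lp_objective_def)
      moreover have "lp_objective p u l 0 = u\<^sup>2 / 2"
        by (simp add: lp_objective_def)
      ultimately show ?thesis
        using \<open>\<not> l \<le> u\<^sup>2 / 2\<close> zero_le_power2[of "u - y"] by linarith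
    qed simp
    then show ?thesis by (auto simp: lp_minimizer_def)
  qed
next
  case False
  have "continuous_on {-\<bar>u\<bar>..\<bar>u\<bar>} (lp_objective p u l)"
    unfolding lp_objective_def using False assms
    by (intro continuous_intros continuous_on_powr') auto
  then obtain x where x: "x \<in> {-\<bar>u\<bar>..\<bar>u\<bar>}"
    and le: "\<And>y. y \<in> {-\<bar>u\<bar>..\<bar>u\<bar>} \<Longrightarrow> lp_objective p u l x \<le> lp_objective p u l y"
    using continuous_attains_inf[of "{-\<bar>u\<bar>..\<bar>u\<bar>}" "lp_objective p u l"] by auto
  have "lp_objective p u l x \<le> lp_objective p u l y" for y
  proof (cases "\<bar>y\<bar> \<le> \<bar>u\<bar>")
    case True
    then show ?thesis by (intro le) auto
  next
    case False
    then have "l * \<bar>u\<bar> powr p \<le> l * \<bar>y\<bar> powr p"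
      using assms by (intro mult_left_mono powr_mono2) auto
    then have "lp_objective p u l u \<le> lp_objective p u l y"
      by (simp add: lp_objective_def add_increasing)
    moreover have "lp_objective p u l x \<le> lp_objective p u l u"
      by (intro le) auto
    ultimately show ?thesis by linarith
  qed
  then show ?thesis by (auto simp: lp_minimizer_def)
qed

section \<open>The thresholding function and its minimizing property\<close>

lemma lp_prox_alt:
  "lp_prox p u l = (if \<exists>!x. lp_minimizer p l u x then THE x. lp_minimizer p l u x else 0)"
  unfolding lp_prox_def is_arg_min_lp_objective ..

lemma lp_prox_eqI:
  assumes "lp_minimizer p l u x" "\<And>y. lp_minimizer p l u y \<Longrightarrow> y = x"
  shows "lp_prox p u l = x"
proof -
  have "\<exists>!x. lp_minimizer p l u x"
    using assms by (rule ex1I)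
  moreover have "(THE x. lp_minimizer p l u x) = x"
    using assms by (rule the_equality)
  ultimately show ?thesis
    by (simp add: lp_prox_alt)
qed

text \<open>In case of a tie at most one minimizer is nonzero, so the default value \<open>0\<close>
  is itself a minimizer.\<close>

lemma lp_minimizer_lp_prox_nonconvex:
  assumes "0 \<le> p" "p < 1" "0 \<le> l"
  shows "lp_minimizer p l u (lp_prox p u l)"
proof (cases "\<exists>!x. lp_minimizer p l u x")
  case True
  then show ?thesis unfolding lp_prox_alt by (simp add: theI')
next
  case False
  then have "lp_minimizer p l u 0"
    using lp_minimizer_exists[OF assms(1,3)] lp_minimizer_unique_nonzero[OF _ _ _ _ assms] by metis
  with False show ?thesis by (simp add: lp_prox_alt)
qed

text \<open>The residual of the projection of \<open>u\<close> onto \<open>{-l..l}\<close>, for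
  \<open>0 \<le> l\<close>; this form exposes the projected value as a subgradient of the
  penalty.\<close>

definition soft :: "real \<Rightarrow> real \<Rightarrow> real" where
  "soft l u = u - max (- l) (min l u)"

text \<open>Strong convexity of the quadratic part, with \<open>c\<close> as subgradient of the
  penalty at \<open>soft l u\<close>; the gap gives optimality and uniqueness together.\<close>

lemma lp_objective_soft_gap:
  assumes "0 \<le> l"
  shows "lp_objective 1 u l (soft l u) + (y - soft l u)\<^sup>2 / 2 \<le> lp_objective 1 u l y"
proof -
  define c where "c = max (- l) (min l u)"
  have sl: "soft l u = u - c" by (simp add: soft_def c_def)
  have "\<bar>c\<bar> * \<bar>y\<bar> \<le> l * \<bar>y\<bar>"
    using assms by (intro mult_right_mono) (auto simp: c_def)
  then have "c * y \<le> l * \<bar>y\<bar>"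
    by (metis abs_ge_self abs_mult order_trans)
  moreover have "c * (u - c) = l * \<bar>u - c\<bar>"
    using assms by (auto simp: c_def max_def min_def algebra_simps)
  moreover have "(u - y)\<^sup>2 / 2 = (u - (u - c))\<^sup>2 / 2 + (y - (u - c))\<^sup>2 / 2 + c * (u - c) - c * y"
    by (simp add: power2_eq_square field_simps)
  ultimately show ?thesis
    unfolding lp_objective_def sl by (simp only: powr_one abs_ge_zero)
qed

lemma lp_minimizer_1_iff:
  assumes "0 \<le> l"
  shows "lp_minimizer 1 l u x \<longleftrightarrow> x = soft l u"
proof
  assume "lp_minimizer 1 l u x"
  then have "lp_objective 1 u l x \<le> lp_objective 1 u l (soft l u)"
    by (simp add: lp_minimizer_def)
  then have "(x - soft l u)\<^sup>2 \<le> 0"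
    using lp_objective_soft_gap[OF assms, of u x] by linarith
  then show "x = soft l u" by simp
next
  assume x: "x = soft l u"
  show "lp_minimizer 1 l u x"
    unfolding lp_minimizer_def x
  proof
    fix y
    show "lp_objective 1 u l (soft l u) \<le> lp_objective 1 u l y"
      using lp_objective_soft_gap[OF assms, of u y] zero_le_power2[of "y - soft l u"] by linarith
  qed
qed

lemma lp_prox_1: "0 \<le> l \<Longrightarrow> lp_prox 1 u l = soft l u"
  by (rule lp_prox_eqI) (simp_all add: lp_minimizer_1_iff)

lemma lp_minimizer_lp_prox:
  assumes "0 \<le> p" "p \<le> 1" "0 \<le> l"
  shows "lp_minimizer p l u (lp_prox p u l)"
  using assms lp_minimizer_lp_prox_nonconvex[of p l u]
  by (cases "p = 1") (simp_all add: lp_prox_1 lp_minimizer_1_iff)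

text \<open>Exchange argument: in the sum of the two optimality inequalities the penalties
  cancel.\<close>

lemma lp_minimizer_mono:
  assumes "lp_minimizer p l u x" "lp_minimizer p l v y" "u < v"
  shows "x \<le> y"
proof -
  have "lp_objective p u l x + lp_objective p v l y \<le> lp_objective p u l y + lp_objective p v l x"
    using assms by (intro add_mono) (auto simp: lp_minimizer_def)
  then have "0 \<le> (v - u) * (y - x)"
    by (simp add: lp_objective_def power2_eq_square field_simps)
  with assms(3) show ?thesis
    by (simp add: zero_le_mult_iff)
qed

lemma borel_measurable_lp_prox:
  assumes "0 \<le> p" "p \<le> 1" "0 \<le> l"
  shows "(\<lambda>u. lp_prox p u l) \<in> borel_measurable borel"
proof (rule borel_measurable_mono, rule monoI)
  fix u v :: real assume "u \<le> v"
  then show "lp_prox p u l \<le> lp_prox p v l"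
    using lp_minimizer_mono[OF lp_minimizer_lp_prox[OF assms] lp_minimizer_lp_prox[OF assms]]
    by (cases "u = v") auto
qed

lemma abs_lp_prox_le: "0 \<le> p \<Longrightarrow> p \<le> 1 \<Longrightarrow> 0 \<le> l \<Longrightarrow> \<bar>lp_prox p u l\<bar> \<le> \<bar>u\<bar>"
  by (rule lp_minimizer_abs_le[OF lp_minimizer_lp_prox])

text \<open>Negation maps the minimizers for \<open>u\<close> bijectively to those for
  \<open>- u\<close>, so uniqueness and ties carry over.\<close>

lemma lp_prox_minus:
  assumes "0 \<le> p" "p \<le> 1" "0 \<le> l"
  shows "lp_prox p (- u) l = - lp_prox p u l"
proof (cases "\<exists>!x. lp_minimizer p l u x")
  case True
  then obtain x where x: "lp_minimizer p l u x" "\<And>y. lp_minimizer p l u y \<Longrightarrow> y = x"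
    by (elim ex1E) blast
  have "lp_prox p (- u) l = - x"
  proof (rule lp_prox_eqI)
    show "lp_minimizer p l (- u) (- x)" using x(1) by (simp add: lp_minimizer_minus_iff)
    show "y = - x" if "lp_minimizer p l (- u) y" for y
      using x(2)[of "- y"] lp_minimizer_minus_iff[of p l u "- y"] that by simp
  qed
  then show ?thesis using lp_prox_eqI[OF x] by simp
next
  case False
  moreover have "lp_minimizer p l (- u) = (\<lambda>x. lp_minimizer p l u (- x))"
    using lp_minimizer_minus_iff[of p l u] by (metis add.inverse_inverse)
  ultimately have "\<not> (\<exists>!x. lp_minimizer p l (- u) x)"
    by (metis add.inverse_inverse)
  with False show ?thesis by (simp only: lp_prox_alt if_False minus_zero)
qed

text \<open>The quadratic gain of \<open>sgn v * \<bar>x\<bar>\<close> over \<open>0\<close> grows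
  with \<open>\<bar>v\<bar>\<close> while its penalty is unchanged. Hence the dead zone is a
  symmetric interval.\<close>

lemma lp_minimizer_nonzero_larger:
  assumes x: "lp_minimizer p l u x" "x \<noteq> 0" and y: "lp_minimizer p l v y" and "\<bar>u\<bar> < \<bar>v\<bar>"
  shows "y \<noteq> 0"
proof
  assume "y = 0"
  then have "lp_objective p v l 0 \<le> lp_objective p v l (sgn v * \<bar>x\<bar>)"
    using y by (simp add: lp_minimizer_def)
  moreover have "v \<noteq> 0" using assms(4) by auto
  ultimately have "v * (sgn v * \<bar>x\<bar>) - x\<^sup>2 / 2 \<le> l * \<bar>x\<bar> powr p"
    by (auto simp: lp_objective_def abs_mult power2_eq_square sgn_if field_simps split: if_splits)
  also have "\<dots> \<le> u * x - x\<^sup>2 / 2"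
    by (rule lp_minimizer_penalty_le[OF x(1)])
  finally have "\<bar>v\<bar> * \<bar>x\<bar> \<le> u * x"
    by (auto simp: sgn_if abs_if split: if_splits)
  also have "u * x \<le> \<bar>u\<bar> * \<bar>x\<bar>"
    by (metis abs_ge_self abs_mult)
  finally show False
    using assms(4) x(2) by (simp add: mult_le_cancel_right)
qed

text \<open>Comparing the objective at a nonzero minimizer with that at \<open>0\<close> gives
  \<open>l * \<bar>x\<bar> powr p \<le> u\<^sup>2 / 2\<close>, where \<open>\<bar>x\<bar>\<close> is bounded below.\<close>

lemma lp_prox_eventually_zero:
  assumes "0 \<le> p" "p < 1"
  shows "eventually (\<lambda>n. lp_prox p u (real n) = 0) sequentially"
proof (cases "u = 0")
  case True
  then show ?thesis
    using abs_lp_prox_le[of p _ u] assms by simp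
next
  case False
  define b where "b = (jump_ratio p * \<bar>u\<bar>) powr p"
  have "0 < b" unfolding b_def using False jump_ratio_pos[of p] assms by simp
  obtain N :: nat where N: "u\<^sup>2 / 2 / b < real N" using reals_Archimedean2 by blast
  have "lp_prox p u (real n) = 0" if "N \<le> n" for n
  proof (rule ccontr)
    let ?x = "lp_prox p u (real n)"
    assume nz: "?x \<noteq> 0"
    have m: "lp_minimizer p (real n) u ?x"
      using assms by (intro lp_minimizer_lp_prox) auto
    have "b \<le> \<bar>?x\<bar> powr p"
      unfolding b_def using lp_minimizer_lower_bound[OF m nz assms] assms jump_ratio_pos[of p]
      by (intro powr_mono2) auto
    then have "real n * b \<le> real n * \<bar>?x\<bar> powr p" by (intro mult_left_mono) auto
    also have "\<dots> \<le> u * ?x - ?x\<^sup>2 / 2" by (rule lp_minimizer_penalty_le[OF m])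
    also have "\<dots> \<le> u\<^sup>2 / 2"
      using zero_le_power2[of "u - ?x"] by (simp add: power2_diff)
    finally have "real n \<le> u\<^sup>2 / 2 / b" using \<open>0 < b\<close> by (simp add: field_simps)
    with N that show False by simp
  qed
  then show ?thesis by (auto simp: eventually_sequentially)
qed

subsection \<open>Risk of the thresholding estimators\<close>

definition prox_risk :: "real \<Rightarrow> real \<Rightarrow> real \<Rightarrow> real \<Rightarrow> real" where
  "prox_risk p \<sigma> l m =
     (\<integral>z. std_normal_density z * (lp_prox p (m + \<sigma> * z) l - m)\<^sup>2 \<partial>lborel)"

definition mixture_risk :: "real \<Rightarrow> real \<Rightarrow> real \<Rightarrow> real \<Rightarrow> real \<Rightarrow> real" where
  "mixture_risk \<epsilon> \<mu> p \<sigma> l = (1 - \<epsilon>) * prox_risk p \<sigma> l 0 + \<epsilon> * prox_risk p \<sigma> l \<mu>"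

definition optimal_risk :: "real \<Rightarrow> real \<Rightarrow> real \<Rightarrow> real \<Rightarrow> real" where
  "optimal_risk \<epsilon> \<mu> p \<sigma> = (INF l\<in>{0..}. mixture_risk \<epsilon> \<mu> p \<sigma> l)"

lemma has_bochner_integral_mono:
  fixes f g :: "'a \<Rightarrow> real"
  assumes "has_bochner_integral M f a" "has_bochner_integral M g b" "\<And>x. f x \<le> g x"
  shows "a \<le> b"
  using assms integral_mono[of M f g] by (auto simp: has_bochner_integral_iff)

lemma borel_measurable_prox_loss:
  assumes "0 \<le> p" "p \<le> 1" "0 \<le> l"
  shows "(\<lambda>z. (lp_prox p (m + \<sigma> * z) l - m)\<^sup>2) \<in> borel_measurable borel"
proof -
  note [measurable] = measurable_compose[OF _ borel_measurable_lp_prox[OF assms]]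
  show ?thesis by measurable
qed

text \<open>The bound is independent of \<open>l\<close>, so it serves both integrability and
  dominated convergence as \<open>l\<close> grows.\<close>

lemma prox_loss_le:
  assumes "0 \<le> p" "p \<le> 1" "0 \<le> l"
  shows "(lp_prox p (m + \<sigma> * z) l - m)\<^sup>2 \<le> 8 * m\<^sup>2 + 2 * \<sigma>\<^sup>2 * z\<^sup>2"
proof -
  have "\<bar>lp_prox p (m + \<sigma> * z) l - m\<bar> \<le> 2 * \<bar>m\<bar> + \<bar>\<sigma> * z\<bar>"
    using abs_lp_prox_le[OF assms, of "m + \<sigma> * z"] by linarith
  then have "(lp_prox p (m + \<sigma> * z) l - m)\<^sup>2 \<le> (2 * \<bar>m\<bar> + \<bar>\<sigma> * z\<bar>)\<^sup>2"
    by (metis abs_ge_zero power2_abs power_mono)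
  also have "\<dots> \<le> 2 * (2 * \<bar>m\<bar>)\<^sup>2 + 2 * \<bar>\<sigma> * z\<bar>\<^sup>2"
    using sum_squares_bound[of "2 * \<bar>m\<bar>" "\<bar>\<sigma> * z\<bar>"] by (simp add: power2_sum)
  finally show ?thesis by (simp add: power_mult_distrib)
qed

lemma has_bochner_integral_std_normal_quadratic:
  "has_bochner_integral lborel (\<lambda>z. std_normal_density z * (a + b * z\<^sup>2)) (a + b)"
proof -
  have "has_bochner_integral lborel
      (\<lambda>z. a * (std_normal_density z * z ^ (2 * 0)) + b * (std_normal_density z * z ^ (2 * 1)))
      (a * (fact (2 * 0) / (2 ^ 0 * fact 0)) + b * (fact (2 * 1) / (2 ^ 1 * fact 1)))"
    by (intro has_bochner_integral_add has_bochner_integral_mult_right std_normal_moment_even)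
  then show ?thesis by (simp add: distrib_left mult.left_commute mult.commute[of a])
qed

lemma integrable_prox_loss:
  assumes "0 \<le> p" "p \<le> 1" "0 \<le> l"
  shows "integrable lborel (\<lambda>z. std_normal_density z * (lp_prox p (m + \<sigma> * z) l - m)\<^sup>2)"
proof (rule Bochner_Integration.integrable_bound)
  show "integrable lborel (\<lambda>z. std_normal_density z * (8 * m\<^sup>2 + (2 * \<sigma>\<^sup>2) * z\<^sup>2))"
    using has_bochner_integral_std_normal_quadratic by (rule integrable.intros)
  show "(\<lambda>z. std_normal_density z * (lp_prox p (m + \<sigma> * z) l - m)\<^sup>2) \<in> borel_measurable lborel"
    using borel_measurable_prox_loss[OF assms, of m \<sigma>] by measurable
  show "AE z in lborel. norm (std_normal_density z * (lp_prox p (m + \<sigma> * z) l - m)\<^sup>2)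
      \<le> norm (std_normal_density z * (8 * m\<^sup>2 + 2 * \<sigma>\<^sup>2 * z\<^sup>2))"
    using prox_loss_le[OF assms, of m \<sigma>] by (auto simp: abs_mult intro!: mult_left_mono)
qed

lemma prox_risk_nonneg: "0 \<le> prox_risk p \<sigma> l m"
  unfolding prox_risk_def by (rule Bochner_Integration.integral_nonneg) simp

text \<open>The noise density is even and the thresholding function odd; this later reduces the
  signal to a positive one.\<close>

lemma prox_risk_minus:
  assumes "0 \<le> p" "p \<le> 1" "0 \<le> l"
  shows "prox_risk p \<sigma> l (- m) = prox_risk p \<sigma> l m"
proof -
  have eq: "lp_prox p (- m + \<sigma> * (0 + - 1 * z)) l = - lp_prox p (m + \<sigma> * z) l" for z
    using lp_prox_minus[OF assms, of "m + \<sigma> * z"] by (simp add: algebra_simps)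
  show ?thesis
    unfolding prox_risk_def
    by (subst lborel_integral_real_affine[where c = "-1" and t = 0], simp, simp only: eq)
      (simp add: std_normal_density_def power2_commute)
qed

lemma prox_risk_abs:
  assumes "0 \<le> p" "p \<le> 1" "0 \<le> l"
  shows "prox_risk p \<sigma> l \<bar>m\<bar> = prox_risk p \<sigma> l m"
  using prox_risk_minus[OF assms] by (simp add: abs_if)

lemma mixture_risk_nonneg:
  assumes "0 \<le> \<epsilon>" "\<epsilon> \<le> 1"
  shows "0 \<le> mixture_risk \<epsilon> \<mu> p \<sigma> l"
  using assms by (simp add: mixture_risk_def prox_risk_nonneg)

lemma mixture_risk_bdd_below:
  assumes "0 \<le> \<epsilon>" "\<epsilon> \<le> 1"
  shows "bdd_below (mixture_risk \<epsilon> \<mu> p \<sigma> ` A)"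
  using mixture_risk_nonneg[OF assms] by (intro bdd_belowI2)

lemma optimal_risk_le:
  assumes "0 \<le> \<epsilon>" "\<epsilon> \<le> 1" "0 \<le> l"
  shows "optimal_risk \<epsilon> \<mu> p \<sigma> \<le> mixture_risk \<epsilon> \<mu> p \<sigma> l"
  unfolding optimal_risk_def using assms by (intro cINF_lower mixture_risk_bdd_below) auto

lemma optimal_risk_greatest:
  assumes "\<And>l. 0 \<le> l \<Longrightarrow> b \<le> mixture_risk \<epsilon> \<mu> p \<sigma> l"
  shows "b \<le> optimal_risk \<epsilon> \<mu> p \<sigma>"
  unfolding optimal_risk_def using assms by (intro cINF_greatest) auto

lemma optimal_risk_nonneg:
  assumes "0 \<le> \<epsilon>" "\<epsilon> \<le> 1"
  shows "0 \<le> optimal_risk \<epsilon> \<mu> p \<sigma>"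
  using mixture_risk_nonneg[OF assms] by (rule optimal_risk_greatest)

text \<open>Substituting \<open>v = \<sigma> * z\<close> moves \<open>\<sigma>\<close> into the density \<open>std_normal_density (v / \<sigma>)\<close>,
  which increases with \<open>\<sigma>\<close>.\<close>

lemma prox_risk_scaled_mono:
  assumes p: "0 \<le> p" "p \<le> 1" "0 \<le> l" and \<sigma>: "0 < \<sigma>" "\<sigma> \<le> \<sigma>'"
  shows "\<sigma> * prox_risk p \<sigma> l m \<le> \<sigma>' * prox_risk p \<sigma>' l m"
proof -
  define f where "f \<sigma> v = std_normal_density (v / \<sigma>) * (lp_prox p (m + v) l - m)\<^sup>2" for \<sigma> v
  have f: "has_bochner_integral lborel (f \<sigma>) (\<sigma> * prox_risk p \<sigma> l m)" if "0 < \<sigma>" for \<sigma>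
  proof -
    have "has_bochner_integral lborel (\<lambda>z. f \<sigma> (0 + \<sigma> * z)) (prox_risk p \<sigma> l m)"
      unfolding f_def prox_risk_def has_bochner_integral_iff
      using integrable_prox_loss[OF p, of m \<sigma>] that by simp
    moreover have "(\<sigma> * prox_risk p \<sigma> l m) /\<^sub>R \<bar>\<sigma>\<bar> = prox_risk p \<sigma> l m"
      using that by simp
    ultimately show ?thesis
      using that lborel_has_bochner_integral_real_affine_iff[of \<sigma> "f \<sigma>" "\<sigma> * prox_risk p \<sigma> l m" 0]
      by (metis less_irrefl)
  qed
  have "f \<sigma> v \<le> f \<sigma>' v" for v
  proof -
    have "\<bar>v / \<sigma>'\<bar> \<le> \<bar>v / \<sigma>\<bar>"
      using \<sigma> by (simp add: divide_left_mono)
    then have "(v / \<sigma>')\<^sup>2 \<le> (v / \<sigma>)\<^sup>2"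
      by (simp only: abs_le_square_iff)
    then have "std_normal_density (v / \<sigma>) \<le> std_normal_density (v / \<sigma>')"
      by (simp add: std_normal_density_def divide_right_mono)
    then show ?thesis unfolding f_def by (rule mult_right_mono) simp
  qed
  then show ?thesis
    using f[of \<sigma>] f[of \<sigma>'] \<sigma> by (metis has_bochner_integral_mono less_le_trans)
qed

lemma optimal_risk_scaled_mono:
  assumes \<epsilon>: "0 \<le> \<epsilon>" "\<epsilon> \<le> 1" and p: "0 \<le> p" "p \<le> 1" and \<sigma>: "0 < \<sigma>" "\<sigma> \<le> \<sigma>'"
  shows "\<sigma> * optimal_risk \<epsilon> \<mu> p \<sigma> \<le> \<sigma>' * optimal_risk \<epsilon> \<mu> p \<sigma>'"
proof -
  have "\<sigma> * optimal_risk \<epsilon> \<mu> p \<sigma> / \<sigma>' \<le> mixture_risk \<epsilon> \<mu> p \<sigma>' l" if "0 \<le> l" for l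
  proof -
    have "\<sigma> * optimal_risk \<epsilon> \<mu> p \<sigma> \<le> \<sigma> * mixture_risk \<epsilon> \<mu> p \<sigma> l"
      using optimal_risk_le[OF \<epsilon> that] \<sigma> by (intro mult_left_mono) auto
    also have "\<dots> = (1 - \<epsilon>) * (\<sigma> * prox_risk p \<sigma> l 0) + \<epsilon> * (\<sigma> * prox_risk p \<sigma> l \<mu>)"
      by (simp add: mixture_risk_def algebra_simps)
    also have "\<dots> \<le> (1 - \<epsilon>) * (\<sigma>' * prox_risk p \<sigma>' l 0) + \<epsilon> * (\<sigma>' * prox_risk p \<sigma>' l \<mu>)"
      using \<epsilon> prox_risk_scaled_mono[OF p that \<sigma>] by (intro add_mono mult_left_mono) auto
    also have "\<dots> = \<sigma>' * mixture_risk \<epsilon> \<mu> p \<sigma>' l"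
      by (simp add: mixture_risk_def algebra_simps)
    finally show ?thesis using \<sigma> by (simp add: field_simps)
  qed
  then have "\<sigma> * optimal_risk \<epsilon> \<mu> p \<sigma> / \<sigma>' \<le> optimal_risk \<epsilon> \<mu> p \<sigma>'"
    by (rule optimal_risk_greatest)
  then show ?thesis using \<sigma> by (simp add: field_simps)
qed

lemma prox_risk_tendsto:
  assumes p: "0 \<le> p" "p < 1"
  shows "(\<lambda>n. prox_risk p \<sigma> (real n) m) \<longlonglongrightarrow> m\<^sup>2"
proof -
  have "(\<lambda>n. prox_risk p \<sigma> (real n) m) \<longlonglongrightarrow> (\<integral>z. std_normal_density z * m\<^sup>2 \<partial>lborel)"
    unfolding prox_risk_def
  proof (rule integral_dominated_convergence[where
        w = "\<lambda>z. std_normal_density z * (8 * m\<^sup>2 + (2 * \<sigma>\<^sup>2) * z\<^sup>2)"])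
    show "integrable lborel (\<lambda>z. std_normal_density z * (8 * m\<^sup>2 + (2 * \<sigma>\<^sup>2) * z\<^sup>2))"
      using has_bochner_integral_std_normal_quadratic by (rule integrable.intros)
    show "(\<lambda>z. std_normal_density z * (lp_prox p (m + \<sigma> * z) (real n) - m)\<^sup>2)
        \<in> borel_measurable lborel" for n
      using integrable_prox_loss[of p "real n" m \<sigma>] p by (intro borel_measurable_integrable) auto
    show "AE z in lborel. norm (std_normal_density z * (lp_prox p (m + \<sigma> * z) (real n) - m)\<^sup>2)
        \<le> std_normal_density z * (8 * m\<^sup>2 + 2 * \<sigma>\<^sup>2 * z\<^sup>2)" for n
      using prox_loss_le[of p "real n" m \<sigma>] p by (auto simp: abs_mult intro!: mult_left_mono)
    show "AE z in lborel. (\<lambda>n. std_normal_density z * (lp_prox p (m + \<sigma> * z) (real n) - m)\<^sup>2)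
        \<longlonglongrightarrow> std_normal_density z * m\<^sup>2"
    proof (rule AE_I2)
      fix z
      have "eventually (\<lambda>n. std_normal_density z * (lp_prox p (m + \<sigma> * z) (real n) - m)\<^sup>2
          = std_normal_density z * m\<^sup>2) sequentially"
        using lp_prox_eventually_zero[OF p, of "m + \<sigma> * z"] by (rule eventually_mono) simp
      then show "(\<lambda>n. std_normal_density z * (lp_prox p (m + \<sigma> * z) (real n) - m)\<^sup>2)
          \<longlonglongrightarrow> std_normal_density z * m\<^sup>2"
        by (rule tendsto_eventually)
    qed
  qed simp
  then show ?thesis
    using has_bochner_integral_std_normal_quadratic[of "m\<^sup>2" 0]
    by (simp add: has_bochner_integral_iff)
qed

text \<open>The zero estimator need not belong to any finite \<open>l\<close>, but its risk is the
  limit of the risks as \<open>l\<close> tends to infinity.\<close>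

lemma optimal_risk_nonconvex_le:
  assumes \<epsilon>: "0 \<le> \<epsilon>" "\<epsilon> \<le> 1" and p: "0 \<le> p" "p < 1"
  shows "optimal_risk \<epsilon> \<mu> p \<sigma> \<le> \<epsilon> * \<mu>\<^sup>2"
proof (rule LIMSEQ_le_const)
  show "(\<lambda>n. mixture_risk \<epsilon> \<mu> p \<sigma> (real n)) \<longlonglongrightarrow> \<epsilon> * \<mu>\<^sup>2"
    unfolding mixture_risk_def
    using tendsto_add[OF tendsto_mult_left[OF prox_risk_tendsto[OF p, of \<sigma> 0], of "1 - \<epsilon>"]
        tendsto_mult_left[OF prox_risk_tendsto[OF p, of \<sigma> \<mu>], of \<epsilon>]] by simp
  show "\<exists>N. \<forall>n\<ge>N. optimal_risk \<epsilon> \<mu> p \<sigma> \<le> mixture_risk \<epsilon> \<mu> p \<sigma> (real n)"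
    using optimal_risk_le[OF \<epsilon>] by auto
qed

text \<open>With \<open>c = jump_ratio p\<close> and \<open>K = 2 * \<bar>\<mu>\<bar> / c\<close>: if the thresholding function vanishes on
  \<open>{-K<..<K}\<close>, then \<open>\<eta>\<^sup>2 \<ge> 2 * \<mu> * \<eta>\<close> everywhere, so it does not beat the zero estimator under
  \<open>\<mu>\<close>. Otherwise it does not vanish outside this interval, hence \<open>\<eta>\<^sup>2 \<ge> c\<^sup>2 * (u\<^sup>2 - K\<^sup>2)\<close>, and
  the risk at mean \<open>0\<close> alone is of order \<open>\<sigma>\<^sup>2\<close>.\<close>

lemma mixture_risk_nonconvex_ge:
  assumes \<epsilon>: "0 \<le> \<epsilon>" "\<epsilon> < 1" and p: "0 \<le> p" "p < 1" and l: "0 \<le> l"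
    and \<sigma>: "(2 * \<bar>\<mu>\<bar> / jump_ratio p)\<^sup>2 + \<epsilon> * \<mu>\<^sup>2 / ((1 - \<epsilon>) * (jump_ratio p)\<^sup>2) \<le> \<sigma>\<^sup>2"
  shows "\<epsilon> * \<mu>\<^sup>2 \<le> mixture_risk \<epsilon> \<mu> p \<sigma> l"
proof -
  define c where "c = jump_ratio p"
  define K where "K = 2 * \<bar>\<mu>\<bar> / c"
  have c: "0 < c" using jump_ratio_pos p by (simp add: c_def)
  have p1: "p \<le> 1" using p by simp
  have min: "lp_minimizer p l u (lp_prox p u l)" for u
    using p l by (intro lp_minimizer_lp_prox) auto
  have lower: "c * \<bar>u\<bar> \<le> \<bar>lp_prox p u l\<bar>" if "lp_prox p u l \<noteq> 0" for u
    unfolding c_def by (rule lp_minimizer_lower_bound[OF min that p])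
  show ?thesis
  proof (cases "\<forall>u. \<bar>u\<bar> < K \<longrightarrow> lp_prox p u l = 0")
    case True
    have ge: "\<mu>\<^sup>2 \<le> (lp_prox p u l - \<mu>)\<^sup>2" for u
    proof (cases "lp_prox p u l = 0")
      case False
      then have "K \<le> \<bar>u\<bar>" using True by force
      then have "2 * \<bar>\<mu>\<bar> \<le> c * \<bar>u\<bar>"
        using c by (simp add: K_def divide_le_eq mult.commute)
      then have "2 * \<bar>\<mu>\<bar> \<le> \<bar>lp_prox p u l\<bar>" using lower[OF False] by linarith
      then have "\<bar>\<mu>\<bar> \<le> \<bar>lp_prox p u l - \<mu>\<bar>" by linarith
      then show ?thesis by (simp only: abs_le_square_iff)
    qed simp
    have "\<mu>\<^sup>2 \<le> prox_risk p \<sigma> l \<mu>"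
      unfolding prox_risk_def
      by (rule has_bochner_integral_mono[OF has_bochner_integral_std_normal_quadratic[of "\<mu>\<^sup>2" 0, simplified]
            has_bochner_integral_integrable[OF integrable_prox_loss[OF p(1) p1 l]]])
        (intro mult_left_mono ge normal_density_nonneg)
    then have "\<epsilon> * \<mu>\<^sup>2 \<le> \<epsilon> * prox_risk p \<sigma> l \<mu>"
      using \<epsilon> by (intro mult_left_mono)
    then show ?thesis
      using \<epsilon> prox_risk_nonneg[of p \<sigma> l 0] by (simp add: mixture_risk_def add_increasing)
  next
    case False
    then obtain u0 where u0: "\<bar>u0\<bar> < K" "lp_prox p u0 l \<noteq> 0" by blast
    have ge: "- (c\<^sup>2 * K\<^sup>2) + c\<^sup>2 * \<sigma>\<^sup>2 * z\<^sup>2 \<le> (lp_prox p (0 + \<sigma> * z) l - 0)\<^sup>2" for z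
    proof (cases "\<bar>\<sigma> * z\<bar> < K")
      case True
      then have "(\<sigma> * z)\<^sup>2 \<le> K\<^sup>2"
        using abs_le_square_iff[of "\<sigma> * z" K] by linarith
      then have "c\<^sup>2 * (\<sigma> * z)\<^sup>2 \<le> c\<^sup>2 * K\<^sup>2"
        by (rule mult_left_mono) simp
      then have "- (c\<^sup>2 * K\<^sup>2) + c\<^sup>2 * \<sigma>\<^sup>2 * z\<^sup>2 \<le> 0"
        by (simp add: power_mult_distrib mult.assoc)
      then show ?thesis by (rule order_trans) simp
    next
      case False
      then have "lp_prox p (\<sigma> * z) l \<noteq> 0"
        using lp_minimizer_nonzero_larger[OF min u0(2) min, of "\<sigma> * z"] u0(1) by linarith
      then have "\<bar>c * (\<sigma> * z)\<bar> \<le> \<bar>lp_prox p (\<sigma> * z) l\<bar>"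
        using lower[of "\<sigma> * z"] c by (simp add: abs_mult)
      then have "(c * (\<sigma> * z))\<^sup>2 \<le> (lp_prox p (\<sigma> * z) l)\<^sup>2"
        by (simp only: abs_le_square_iff)
      moreover have "0 \<le> c\<^sup>2 * K\<^sup>2" by simp
      ultimately show ?thesis
        by (simp only: power_mult_distrib mult.assoc add_0 diff_zero)
    qed
    have "- (c\<^sup>2 * K\<^sup>2) + c\<^sup>2 * \<sigma>\<^sup>2 \<le> prox_risk p \<sigma> l 0"
      unfolding prox_risk_def
      by (rule has_bochner_integral_mono[OF has_bochner_integral_std_normal_quadratic
            has_bochner_integral_integrable[OF integrable_prox_loss[OF p(1) p1 l]]])
        (intro mult_left_mono ge normal_density_nonneg)
    \<comment> \<open>The lower bound on \<open>\<sigma>\<^sup>2\<close> is calibrated for this: the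
      risk at mean \<open>0\<close>, weighted by \<open>1 - \<epsilon>\<close>, already reaches
      \<open>\<epsilon> * \<mu>\<^sup>2\<close>.\<close>
    moreover have "\<epsilon> * \<mu>\<^sup>2 / (1 - \<epsilon>) \<le> - (c\<^sup>2 * K\<^sup>2) + c\<^sup>2 * \<sigma>\<^sup>2"
    proof -
      have "c\<^sup>2 * (\<epsilon> * \<mu>\<^sup>2 / ((1 - \<epsilon>) * c\<^sup>2)) \<le> c\<^sup>2 * (\<sigma>\<^sup>2 - K\<^sup>2)"
        using \<sigma> by (intro mult_left_mono) (simp_all add: c_def K_def)
      moreover have "c\<^sup>2 * (\<epsilon> * \<mu>\<^sup>2 / ((1 - \<epsilon>) * c\<^sup>2)) = \<epsilon> * \<mu>\<^sup>2 / (1 - \<epsilon>)"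
        using c by simp
      ultimately show ?thesis by (simp add: right_diff_distrib)
    qed
    ultimately have "\<epsilon> * \<mu>\<^sup>2 / (1 - \<epsilon>) \<le> prox_risk p \<sigma> l 0" by linarith
    then have "\<epsilon> * \<mu>\<^sup>2 \<le> (1 - \<epsilon>) * prox_risk p \<sigma> l 0"
      using \<epsilon> by (simp add: divide_le_eq mult.commute)
    then show ?thesis
      using \<epsilon> prox_risk_nonneg[of p \<sigma> l \<mu>] by (simp add: mixture_risk_def add_increasing2)
  qed
qed

subsection \<open>Soft thresholding\<close>

lemma soft_scale: "0 \<le> k \<Longrightarrow> soft (k * l) (k * u) = k * soft l u"
  by (simp add: soft_def max_mult_distrib_left min_mult_distrib_left right_diff_distrib)

text \<open>\<open>soft l (m + y) - m = y - max (- l) (min l (m + y))\<close> is monotone in \<open>m\<close>, and equals \<open>- m\<close> in the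
  dead zone, so its absolute value grows along each ray from \<open>0\<close>.\<close>

lemma abs_soft_error_mono:
  assumes "0 \<le> l" "0 \<le> \<theta>" "\<theta> \<le> 1"
  shows "\<bar>soft l (\<theta> * m + y) - \<theta> * m\<bar> \<le> \<bar>soft l (m + y) - m\<bar>"
proof -
  have "0 \<le> \<theta> * m \<and> \<theta> * m \<le> m \<or> m \<le> \<theta> * m \<and> \<theta> * m \<le> 0"
    using assms by (cases "0 \<le> m") (auto simp: mult_left_le_one_le mult_le_cancel_right1 mult_nonneg_nonpos)
  then show ?thesis
    using assms(1) unfolding soft_def by linarith
qed

lemma prox_risk_1_scale:
  assumes "0 \<le> k" "0 \<le> l"
  shows "prox_risk 1 (k * \<sigma>) (k * l) (k * m) = k\<^sup>2 * prox_risk 1 \<sigma> l m"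
proof -
  have "(lp_prox 1 (k * m + k * \<sigma> * z) (k * l) - k * m)\<^sup>2 = k\<^sup>2 * (lp_prox 1 (m + \<sigma> * z) l - m)\<^sup>2" for z
    using soft_scale[OF assms(1), of l "m + \<sigma> * z"] assms
    by (simp add: lp_prox_1 distrib_left mult.assoc power_mult_distrib right_diff_distrib[symmetric])
  then show ?thesis
    unfolding prox_risk_def
    by (simp only: mult.left_commute[of _ "k\<^sup>2"] integral_mult_right_zero)
qed

lemma prox_risk_1_mono:
  assumes "0 \<le> l" "0 \<le> \<theta>" "\<theta> \<le> 1"
  shows "prox_risk 1 \<sigma> l (\<theta> * m) \<le> prox_risk 1 \<sigma> l m"
proof -
  have "(lp_prox 1 (\<theta> * m + y) l - \<theta> * m)\<^sup>2 \<le> (lp_prox 1 (m + y) l - m)\<^sup>2" for y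
    using abs_soft_error_mono[OF assms, of m y] assms(1) by (simp add: lp_prox_1 abs_le_square_iff)
  then show ?thesis
    unfolding prox_risk_def using assms(1)
    by (intro integral_mono integrable_prox_loss mult_left_mono) auto
qed

text \<open>By homogeneity, noise \<open>k * \<sigma>\<close> with threshold \<open>k * l\<close>
  and signal \<open>m\<close> has \<open>k\<^sup>2\<close> times the risk at noise
  \<open>\<sigma>\<close>, threshold \<open>l\<close> and the smaller signal \<open>m / k\<close>,
  and shrinking the signal does not increase this risk.\<close>

lemma optimal_risk_1_ratio_antimono:
  assumes \<epsilon>: "0 \<le> \<epsilon>" "\<epsilon> \<le> 1" and \<sigma>: "0 < \<sigma>" "\<sigma> \<le> \<sigma>'"
  shows "optimal_risk \<epsilon> \<mu> 1 \<sigma>' / \<sigma>'\<^sup>2 \<le> optimal_risk \<epsilon> \<mu> 1 \<sigma> / \<sigma>\<^sup>2"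
proof -
  define k where "k = \<sigma>' / \<sigma>"
  have k: "1 \<le> k" "\<sigma>' = k * \<sigma>" using \<sigma> by (simp_all add: k_def)
  have risk: "prox_risk 1 \<sigma>' (k * l) m \<le> k\<^sup>2 * prox_risk 1 \<sigma> l m" if "0 \<le> l" for l m
    using prox_risk_1_scale[of k l \<sigma> "m / k"] prox_risk_1_mono[of l "1 / k" \<sigma> m] k that
    by (simp add: mult_left_mono)
  have "optimal_risk \<epsilon> \<mu> 1 \<sigma>' / k\<^sup>2 \<le> mixture_risk \<epsilon> \<mu> 1 \<sigma> l" if "0 \<le> l" for l
  proof -
    have "optimal_risk \<epsilon> \<mu> 1 \<sigma>' \<le> mixture_risk \<epsilon> \<mu> 1 \<sigma>' (k * l)"
      using k that by (intro optimal_risk_le \<epsilon>) simp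
    also have "\<dots> \<le> (1 - \<epsilon>) * (k\<^sup>2 * prox_risk 1 \<sigma> l 0) + \<epsilon> * (k\<^sup>2 * prox_risk 1 \<sigma> l \<mu>)"
      unfolding mixture_risk_def using risk[OF that] \<epsilon> by (intro add_mono mult_left_mono) auto
    also have "\<dots> = k\<^sup>2 * mixture_risk \<epsilon> \<mu> 1 \<sigma> l"
      by (simp add: mixture_risk_def algebra_simps)
    finally show ?thesis using k by (simp add: divide_le_eq mult.commute)
  qed
  then have "optimal_risk \<epsilon> \<mu> 1 \<sigma>' / k\<^sup>2 \<le> optimal_risk \<epsilon> \<mu> 1 \<sigma>"
    by (rule optimal_risk_greatest)
  then show ?thesis
    using \<sigma> k by (simp add: k(2) power_mult_distrib field_simps)
qed

text \<open>An unnormalized Erlang density. Being zero on negative arguments, it lets the bounds for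
  the two tails be added on the whole line.\<close>

definition exp_monomial :: "nat \<Rightarrow> real \<Rightarrow> real \<Rightarrow> real" where
  "exp_monomial k l w = (if w < 0 then 0 else w ^ k * exp (- l * w))"

lemma has_bochner_integral_exp_monomial:
  assumes "0 < l"
  shows "has_bochner_integral lborel (exp_monomial k l) (fact k / l ^ Suc k)"
proof -
  have eq: "exp_monomial k l = (\<lambda>w. fact k / l ^ Suc k * erlang_density k l w)"
    using assms by (auto simp: exp_monomial_def erlang_density_def)
  have "has_bochner_integral lborel (erlang_density k l) 1"
    using nn_integral_erlang_ith_moment[OF assms, of k 0] assms
    by (intro has_bochner_integral_nn_integral) auto
  then have "has_bochner_integral lborel (\<lambda>w. fact k / l ^ Suc k * erlang_density k l w) (fact k / l ^ Suc k * 1)"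
    by (rule has_bochner_integral_mult_right)
  then show ?thesis
    unfolding eq by simp
qed

lemma has_bochner_integral_exp_monomial_affine:
  assumes "0 < l" "\<bar>c\<bar> = 1"
  shows "has_bochner_integral lborel (\<lambda>y. exp_monomial k l (t + c * y)) (fact k / l ^ Suc k)"
  using has_bochner_integral_exp_monomial[OF assms(1), of k] assms(2)
    lborel_has_bochner_integral_real_affine_iff[of c "exp_monomial k l" "fact k / l ^ Suc k" t]
  by fastforce

section \<open>Gaussian tail estimates beyond the threshold\<close>

lemma std_normal_density_add:
  "std_normal_density (t + w) = std_normal_density t * exp (- t * w) * exp (- w\<^sup>2 / 2)"
proof -
  have "- (t + w)\<^sup>2 / 2 = - t\<^sup>2 / 2 + - t * w + - w\<^sup>2 / 2"
    by (simp add: power2_eq_square field_simps)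
  then show ?thesis
    unfolding std_normal_density_def by (simp only: exp_add mult.assoc)
qed

text \<open>Beyond the threshold \<open>t\<close>, the excess loss of soft thresholding over the zero estimator at mean
  \<open>a\<close> is \<open>w\<^sup>2 - 2 * a * w\<close> with \<open>w = y - t\<close>; the density gains the large factor
  \<open>exp (a * t - a\<^sup>2 / 2)\<close> relative to mean \<open>0\<close>.\<close>

lemma soft_excess_upper_tail:
  assumes "0 < a" "0 < t" "0 \<le> w"
  shows "std_normal_density (t + w) * w\<^sup>2 \<le> std_normal_density t * exp_monomial 2 t w"
    and "std_normal_density (t + w - a) * (w\<^sup>2 - 2 * a * w)
      \<le> std_normal_density t * exp (a * t - a\<^sup>2 / 2) *
        (exp_monomial 2 (t - a) w - 2 * a * exp_monomial 1 t w + a * exp_monomial 3 t w)"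
proof -
  define q where "q = exp (- w\<^sup>2 / 2)"
  define r where "r = exp (a * w)"
  have q: "1 - w\<^sup>2 / 2 \<le> q" "q \<le> 1" "0 \<le> q"
    using exp_ge_add_one_self[of "- w\<^sup>2 / 2"] by (simp_all add: q_def)
  have r: "1 \<le> r" using assms by (simp add: r_def)
  have "q * w\<^sup>2 \<le> w\<^sup>2" using q by (simp add: mult_left_le_one_le)
  then have "std_normal_density t * exp (- t * w) * (q * w\<^sup>2) \<le> std_normal_density t * exp (- t * w) * w\<^sup>2"
    by (rule mult_left_mono) simp
  then show "std_normal_density (t + w) * w\<^sup>2 \<le> std_normal_density t * exp_monomial 2 t w"
    using assms by (simp add: exp_monomial_def std_normal_density_add q_def ac_simps)
  have "q * (r * w\<^sup>2) \<le> r * w\<^sup>2"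
    using q r by (intro mult_left_le_one_le) auto
  moreover have "(1 - w\<^sup>2 / 2) * (2 * a * w) \<le> q * (2 * a * w)"
    using q assms by (intro mult_right_mono) auto
  moreover have "1 * (q * (2 * a * w)) \<le> r * (q * (2 * a * w))"
    using q r assms by (intro mult_right_mono) auto
  ultimately have bound: "q * r * (w\<^sup>2 - 2 * a * w) \<le> r * w\<^sup>2 - 2 * a * w + a * w ^ 3"
    by (simp add: algebra_simps power2_eq_square power3_eq_cube)
  have dens: "std_normal_density (t + w - a)
      = std_normal_density t * exp (a * t - a\<^sup>2 / 2) * exp (- t * w) * (q * r)"
  proof -
    have "- (t + w - a)\<^sup>2 / 2 = - t\<^sup>2 / 2 + (a * t - a\<^sup>2 / 2) + - t * w + - w\<^sup>2 / 2 + a * w"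
      by (simp add: power2_eq_square field_simps)
    then show ?thesis
      unfolding std_normal_density_def q_def r_def by (simp only: exp_add mult.assoc)
  qed
  have "std_normal_density (t + w - a) * (w\<^sup>2 - 2 * a * w)
      = std_normal_density t * exp (a * t - a\<^sup>2 / 2) * (exp (- t * w) * (q * r * (w\<^sup>2 - 2 * a * w)))"
    by (simp add: dens)
  also have "\<dots> \<le> std_normal_density t * exp (a * t - a\<^sup>2 / 2) *
      (exp (- t * w) * (r * w\<^sup>2 - 2 * a * w + a * w ^ 3))"
    using bound by (intro mult_left_mono) auto
  also have "exp (- t * w) * (r * w\<^sup>2 - 2 * a * w + a * w ^ 3)
      = exp_monomial 2 (t - a) w - 2 * a * exp_monomial 1 t w + a * exp_monomial 3 t w"
  proof -
    have "exp (- (t - a) * w) = exp (- t * w) * r"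
      by (simp add: r_def exp_add[symmetric] algebra_simps)
    then show ?thesis
      using assms(3) by (simp add: exp_monomial_def algebra_simps)
  qed
  finally show "std_normal_density (t + w - a) * (w\<^sup>2 - 2 * a * w)
      \<le> std_normal_density t * exp (a * t - a\<^sup>2 / 2) *
        (exp_monomial 2 (t - a) w - 2 * a * exp_monomial 1 t w + a * exp_monomial 3 t w)" .
qed

text \<open>On this side the mean \<open>a\<close> moves the density away from the tail: it is at
  most the density at mean \<open>0\<close>, so the unfavourable excess
  \<open>w\<^sup>2 + 2 * a * w\<close> picks up no growing factor.\<close>

lemma soft_excess_lower_tail:
  assumes "0 < a" "0 < t" "0 \<le> w"
  shows "std_normal_density (- (t + w) - a) * (w\<^sup>2 + 2 * a * w)
    \<le> std_normal_density t * (exp_monomial 2 t w + 2 * a * exp_monomial 1 t w)"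
proof -
  have "\<bar>t + w\<bar> \<le> \<bar>- (t + w) - a\<bar>" using assms by linarith
  then have "(t + w)\<^sup>2 \<le> (- (t + w) - a)\<^sup>2" by (simp only: abs_le_square_iff)
  then have "std_normal_density (- (t + w) - a) \<le> std_normal_density (t + w)"
    by (simp add: std_normal_density_def divide_right_mono)
  also have "\<dots> \<le> std_normal_density t * exp (- t * w)"
    unfolding std_normal_density_add by (simp add: mult_left_le)
  finally have "std_normal_density (- (t + w) - a) * (w\<^sup>2 + 2 * a * w)
      \<le> std_normal_density t * exp (- t * w) * (w\<^sup>2 + 2 * a * w)"
    using assms by (intro mult_right_mono) auto
  then show ?thesis
    using assms by (simp add: exp_monomial_def algebra_simps)
qed

text \<open>Integrating over the observation \<open>y\<close> instead of the noise puts the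
  threshold at the same place for both mixture components.\<close>

lemma prox_risk_shift:
  assumes "0 \<le> p" "p \<le> 1" "0 \<le> l"
  shows "has_bochner_integral lborel
    (\<lambda>y. std_normal_density (y - m) * (lp_prox p y l - m)\<^sup>2) (prox_risk p 1 l m)"
  using has_bochner_integral_integrable[OF integrable_prox_loss[OF assms, of m 1]]
    lborel_has_bochner_integral_real_affine_iff[of 1
      "\<lambda>y. std_normal_density (y - m) * (lp_prox p y l - m)\<^sup>2" "prox_risk p 1 l m" m]
  by (simp add: prox_risk_def)

text \<open>The excess over the zero estimator vanishes between \<open>- t\<close> and
  \<open>t\<close>. The three summands come from the upper tail at mean \<open>0\<close>, the upper
  tail at mean \<open>a\<close>, and the lower tail for both means.\<close>

lemma mixture_risk_1_excess_le:
  assumes \<epsilon>: "0 \<le> \<epsilon>" "\<epsilon> \<le> 1" and a: "0 < a" "a < t"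
  shows "mixture_risk \<epsilon> a 1 1 t - \<epsilon> * a\<^sup>2
    \<le> std_normal_density t * ((1 - \<epsilon>) * (2 / t ^ 3)
      + \<epsilon> * exp (a * t - a\<^sup>2 / 2) * (2 / (t - a) ^ 3 - 2 * a * (1 / t\<^sup>2) + a * (6 / t ^ 4))
      + (2 / t ^ 3 + 2 * \<epsilon> * a * (1 / t\<^sup>2)))"
proof (rule has_bochner_integral_mono)
  let ?\<phi> = std_normal_density and ?E = "exp (a * t - a\<^sup>2 / 2)"
  have t: "0 < t" using a by simp
  have "has_bochner_integral lborel (\<lambda>y. ?\<phi> (y - a)) 1"
    using has_bochner_integral_std_normal_quadratic[of 1 0]
      lborel_has_bochner_integral_real_affine_iff[of 1 "\<lambda>y. ?\<phi> (y - a)" 1 a]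
    by simp
  then have "has_bochner_integral lborel
      (\<lambda>y. (1 - \<epsilon>) * (?\<phi> (y - 0) * (lp_prox 1 y t - 0)\<^sup>2) + \<epsilon> * (?\<phi> (y - a) * (lp_prox 1 y t - a)\<^sup>2)
         - \<epsilon> * a\<^sup>2 * ?\<phi> (y - a))
      ((1 - \<epsilon>) * prox_risk 1 1 t 0 + \<epsilon> * prox_risk 1 1 t a - \<epsilon> * a\<^sup>2 * 1)"
    using t by (intro has_bochner_integral_add has_bochner_integral_diff has_bochner_integral_mult_right
        prox_risk_shift) auto
  moreover have "(\<lambda>y. (1 - \<epsilon>) * (?\<phi> (y - 0) * (lp_prox 1 y t - 0)\<^sup>2) + \<epsilon> * (?\<phi> (y - a) * (lp_prox 1 y t - a)\<^sup>2)
         - \<epsilon> * a\<^sup>2 * ?\<phi> (y - a))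
       = (\<lambda>y. (1 - \<epsilon>) * (?\<phi> y * (soft t y)\<^sup>2) + \<epsilon> * (?\<phi> (y - a) * ((soft t y)\<^sup>2 - 2 * a * soft t y)))"
    using t by (intro ext) (simp add: lp_prox_1 power2_eq_square algebra_simps)
  ultimately show "has_bochner_integral lborel
      (\<lambda>y. (1 - \<epsilon>) * (?\<phi> y * (soft t y)\<^sup>2) + \<epsilon> * (?\<phi> (y - a) * ((soft t y)\<^sup>2 - 2 * a * soft t y)))
      (mixture_risk \<epsilon> a 1 1 t - \<epsilon> * a\<^sup>2)"
    by (simp add: mixture_risk_def)
  \<comment> \<open>Up to the factor \<open>std_normal_density t\<close>, \<open>U\<close> and
    \<open>L\<close> majorize the upper and lower tail in the distances \<open>- t + y\<close> and
    \<open>- t - y\<close>; off its own tail each has a negative argument and vanishes.\<close>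
  define U where "U w = (1 - \<epsilon>) * exp_monomial 2 t w + \<epsilon> * ?E *
      (exp_monomial 2 (t - a) w - 2 * a * exp_monomial 1 t w + a * exp_monomial 3 t w)" for w
  define L where "L w = exp_monomial 2 t w + 2 * \<epsilon> * a * exp_monomial 1 t w" for w
  note moment = has_bochner_integral_exp_monomial_affine
  have "has_bochner_integral lborel (\<lambda>y. ?\<phi> t * (U (- t + 1 * y) + L (- t + (- 1) * y)))
     (?\<phi> t * ((1 - \<epsilon>) * (fact 2 / t ^ Suc 2) + \<epsilon> * ?E *
        (fact 2 / (t - a) ^ Suc 2 - 2 * a * (fact 1 / t ^ Suc 1) + a * (fact 3 / t ^ Suc 3))
        + (fact 2 / t ^ Suc 2 + 2 * \<epsilon> * a * (fact 1 / t ^ Suc 1))))"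
    unfolding U_def L_def using t a
    by (intro has_bochner_integral_add has_bochner_integral_diff has_bochner_integral_mult_right moment) auto
  then show "has_bochner_integral lborel (\<lambda>y. ?\<phi> t * (U (- t + 1 * y) + L (- t + (- 1) * y)))
     (?\<phi> t * ((1 - \<epsilon>) * (2 / t ^ 3)
      + \<epsilon> * ?E * (2 / (t - a) ^ 3 - 2 * a * (1 / t\<^sup>2) + a * (6 / t ^ 4))
      + (2 / t ^ 3 + 2 * \<epsilon> * a * (1 / t\<^sup>2))))"
    by (simp add: fact_numeral numeral_3_eq_3 numeral_2_eq_2 numeral_eq_Suc)
  show "(1 - \<epsilon>) * (?\<phi> y * (soft t y)\<^sup>2) + \<epsilon> * (?\<phi> (y - a) * ((soft t y)\<^sup>2 - 2 * a * soft t y))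
      \<le> ?\<phi> t * (U (- t + 1 * y) + L (- t + (- 1) * y))" for y
  proof -
    consider "t \<le> y" | "y \<le> - t" | "\<bar>y\<bar> < t" by linarith
    then show ?thesis
    proof cases
      case 1
      define w where "w = y - t"
      have w: "0 \<le> w" "y = t + w" "soft t y = w" "- t + 1 * y = w" "- t + (- 1) * y < 0"
        using 1 t by (auto simp: w_def soft_def)
      have "L (- t + (- 1) * y) = 0" using w(5) by (simp add: L_def exp_monomial_def)
      moreover have "(1 - \<epsilon>) * (?\<phi> y * w\<^sup>2) + \<epsilon> * (?\<phi> (y - a) * (w\<^sup>2 - 2 * a * w))
          \<le> (1 - \<epsilon>) * (?\<phi> t * exp_monomial 2 t w) + \<epsilon> * (?\<phi> t * ?E *
            (exp_monomial 2 (t - a) w - 2 * a * exp_monomial 1 t w + a * exp_monomial 3 t w))"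
        unfolding w(2) using \<epsilon> soft_excess_upper_tail[OF a(1) t w(1)]
        by (intro add_mono mult_left_mono) auto
      moreover have "\<dots> = ?\<phi> t * U w"
        by (simp add: U_def algebra_simps)
      ultimately show ?thesis unfolding w(3,4) by simp
    next
      case 2
      define w where "w = - t - y"
      have w: "0 \<le> w" "y = - (t + w)" "soft t y = - w" "- t + (- 1) * y = w" "- t + 1 * y < 0"
        using 2 t by (auto simp: w_def soft_def)
      have "U (- t + 1 * y) = 0" using w(5) by (simp add: U_def exp_monomial_def)
      moreover have "(1 - \<epsilon>) * (?\<phi> (t + w) * w\<^sup>2) + \<epsilon> * (?\<phi> (- (t + w) - a) * (w\<^sup>2 + 2 * a * w))
          \<le> (1 - \<epsilon>) * (?\<phi> t * exp_monomial 2 t w) + \<epsilon> * (?\<phi> t * (exp_monomial 2 t w + 2 * a * exp_monomial 1 t w))"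
        using \<epsilon> soft_excess_upper_tail(1)[OF a(1) t w(1)] soft_excess_lower_tail[OF a(1) t w(1)]
        by (intro add_mono mult_left_mono) auto
      moreover have "\<dots> = ?\<phi> t * L w"
        by (simp add: L_def algebra_simps)
      moreover have "?\<phi> y = ?\<phi> (t + w)" unfolding w(2) std_normal_density_def power2_minus ..
      ultimately show ?thesis unfolding w(3,4) using w(2) by simp
    next
      case 3
      then have "soft t y = 0" "- t + 1 * y < 0" "- t + (- 1) * y < 0"
        by (auto simp: soft_def)
      then show ?thesis by (simp add: U_def L_def exp_monomial_def)
    qed
  qed
qed

text \<open>At threshold \<open>t = x / a\<close> the excess risk is at most a positive multiple of
  \<open>2 + x - \<epsilon> * exp (x - 1) * (x - 3)\<close>; the choice of \<open>x\<close> makes this negative.\<close>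

lemma soft_threshold_gain:
  assumes \<epsilon>: "0 < \<epsilon>" "\<epsilon> \<le> 1" and a: "0 < a" "a \<le> 1"
  obtains t where "0 \<le> t" "mixture_risk \<epsilon> a 1 1 t < \<epsilon> * a\<^sup>2"
proof -
  \<comment> \<open>Chosen so that \<open>8 \<le> x\<close> and
    \<open>4 < \<epsilon> * (x - 1)\<close>.\<close>
  define x where "x = 4 + 4 / \<epsilon>"
  define t where "t = x / a"
  define E where "E = exp (a * t - a\<^sup>2 / 2)"
  have x: "8 \<le> x" using \<epsilon> by (simp add: x_def le_divide_eq)
  have at: "a * t = x" using a by (simp add: t_def)
  have "x / 1 \<le> x / a" using a x by (intro divide_left_mono) auto
  then have t: "8 \<le> t" "5 * a \<le> t" "x \<le> t" using a x by (simp_all add: t_def)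
  \<comment> \<open>As \<open>a \<le> 1\<close>, the exponent in \<open>E\<close> is at least
    \<open>x - 1\<close>; the quadratic Taylor term suffices against the linear
    \<open>2 + x\<close>.\<close>
  have "(x - 1)\<^sup>2 / 2 \<le> exp (x - 1)"
    using exp_lower_Taylor_quadratic[of "x - 1"] x by simp
  also have "exp (x - 1) \<le> E"
    using a power_le_one[of a 2] by (simp add: E_def at)
  finally have E: "(x - 1)\<^sup>2 / 2 \<le> E" .
  have "4 < \<epsilon> * (x - 1)" using \<epsilon> by (simp add: x_def algebra_simps)
  then have "4 * (x - 1) < \<epsilon> * (x - 1) * (x - 1)"
    using x by (intro mult_strict_right_mono) auto
  then have "2 * (x - 1) < \<epsilon> * (x - 1) * (x - 1) / 2" by simp
  moreover have "2 + x < 2 * (x - 1)" using x by simp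
  ultimately have "2 + x < \<epsilon> * (x - 1) * (x - 1) / 2" by linarith
  also have "\<dots> \<le> \<epsilon> * E * 1"
    using E \<epsilon> by (simp add: power2_eq_square mult.assoc mult_left_mono)
  also have "\<dots> \<le> \<epsilon> * E * (x - 3)"
    using \<epsilon> x by (intro mult_left_mono) (auto simp: E_def)
  finally have key: "2 + x + \<epsilon> * E * (3 - x) < 0"
    by (simp add: algebra_simps)
  \<comment> \<open>By \<open>5 * a \<le> t\<close>, \<open>t - a\<close> is at least
    \<open>4 / 5\<close> of \<open>t\<close>, and the cube \<open>64 / 125\<close> exceeds one
    half.\<close>
  have "(t * (4 / 5)) ^ 3 \<le> (t - a) ^ 3"
    using t by (intro power_mono) auto
  moreover have "(t * (4 / 5)) ^ 3 = t ^ 3 * (64 / 125)" "0 \<le> t ^ 3"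
    using t unfolding power_mult_distrib by (simp_all add: power3_eq_cube)
  ultimately have "t ^ 3 / 2 \<le> (t - a) ^ 3" by linarith
  then have "2 / (t - a) ^ 3 \<le> 2 / (t ^ 3 / 2)"
    using t a by (intro divide_left_mono) auto
  then have b1: "2 / (t - a) ^ 3 \<le> 2 / t ^ 3 * 2" by simp
  \<comment> \<open>With \<open>a = x / t\<close> this too is a multiple of
    \<open>2 / t ^ 3\<close>, the factor extracted from the whole bound.\<close>
  have b2: "2 * a * (1 / t\<^sup>2) = 2 / t ^ 3 * x"
    using t by (simp add: at[symmetric] power2_eq_square power3_eq_cube)
  have "3 * a / t \<le> 1" using t a by simp
  then have "2 / t ^ 3 * (3 * a / t) \<le> 2 / t ^ 3 * 1"
    using t by (intro mult_left_mono) auto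
  then have b3: "a * (6 / t ^ 4) \<le> 2 / t ^ 3"
    by (simp add: power3_eq_cube power4_eq_xxxx mult.commute)
  have "(1 - \<epsilon>) * (2 / t ^ 3) + \<epsilon> * E * (2 / (t - a) ^ 3 - 2 * a * (1 / t\<^sup>2) + a * (6 / t ^ 4))
      + (2 / t ^ 3 + 2 * \<epsilon> * a * (1 / t\<^sup>2))
      \<le> 1 * (2 / t ^ 3) + \<epsilon> * E * (2 / t ^ 3 * 2 - 2 / t ^ 3 * x + 2 / t ^ 3)
      + (2 / t ^ 3 + 1 * (2 / t ^ 3 * x))"
  proof (intro add_mono mult_right_mono mult_left_mono order_refl)
    show "2 / (t - a) ^ 3 - 2 * a * (1 / t\<^sup>2) \<le> 2 / t ^ 3 * 2 - 2 / t ^ 3 * x"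
      using b1 b2 by simp
    have "2 * \<epsilon> * a * (1 / t\<^sup>2) = \<epsilon> * (2 * a * (1 / t\<^sup>2))" by simp
    also have "\<dots> \<le> 1 * (2 / t ^ 3 * x)"
      unfolding b2 using \<epsilon> t x by (intro mult_right_mono) auto
    finally show "2 * \<epsilon> * a * (1 / t\<^sup>2) \<le> 1 * (2 / t ^ 3 * x)" .
  qed (use \<epsilon> t b3 in \<open>auto simp: E_def\<close>)
  also have "\<dots> = 2 / t ^ 3 * (2 + x + \<epsilon> * E * (3 - x))"
    by (simp add: algebra_simps)
  also have "\<dots> < 0"
    using key t by (intro mult_pos_neg) auto
  finally have "std_normal_density t *
      ((1 - \<epsilon>) * (2 / t ^ 3) + \<epsilon> * E * (2 / (t - a) ^ 3 - 2 * a * (1 / t\<^sup>2) + a * (6 / t ^ 4))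
      + (2 / t ^ 3 + 2 * \<epsilon> * a * (1 / t\<^sup>2))) < 0"
    by (intro mult_pos_neg) (simp_all add: std_normal_density_def)
  moreover have "mixture_risk \<epsilon> a 1 1 t - \<epsilon> * a\<^sup>2 \<le> std_normal_density t *
      ((1 - \<epsilon>) * (2 / t ^ 3) + \<epsilon> * E * (2 / (t - a) ^ 3 - 2 * a * (1 / t\<^sup>2) + a * (6 / t ^ 4))
      + (2 / t ^ 3 + 2 * \<epsilon> * a * (1 / t\<^sup>2)))"
    unfolding E_def using \<epsilon> a t by (intro mixture_risk_1_excess_le) auto
  ultimately show ?thesis
    using t by (intro that[of t]) auto
qed

text \<open>Rescaling by \<open>\<sigma>\<close> gives unit noise and signal
  \<open>\<bar>\<mu>\<bar> / \<sigma>\<close>, which lies in the range of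
  \<open>soft_threshold_gain\<close>.\<close>

lemma optimal_risk_1_less:
  assumes \<epsilon>: "0 < \<epsilon>" "\<epsilon> \<le> 1" and \<mu>: "\<mu> \<noteq> 0" "\<bar>\<mu>\<bar> \<le> \<sigma>"
  shows "optimal_risk \<epsilon> \<mu> 1 \<sigma> < \<epsilon> * \<mu>\<^sup>2"
proof -
  have \<sigma>: "0 < \<sigma>" using \<mu> by linarith
  obtain t where t: "0 \<le> t" "mixture_risk \<epsilon> (\<bar>\<mu>\<bar> / \<sigma>) 1 1 t < \<epsilon> * (\<bar>\<mu>\<bar> / \<sigma>)\<^sup>2"
    using soft_threshold_gain[OF \<epsilon>, of "\<bar>\<mu>\<bar> / \<sigma>"] \<mu> \<sigma> by auto
  have "optimal_risk \<epsilon> \<mu> 1 \<sigma> \<le> mixture_risk \<epsilon> \<mu> 1 \<sigma> (\<sigma> * t)"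
    using \<epsilon> \<sigma> t by (intro optimal_risk_le) auto
  also have "\<dots> = \<sigma>\<^sup>2 * mixture_risk \<epsilon> (\<bar>\<mu>\<bar> / \<sigma>) 1 1 t"
    using prox_risk_1_scale[of \<sigma> t 1 0] prox_risk_1_scale[of \<sigma> t 1 "\<bar>\<mu>\<bar> / \<sigma>"] \<sigma> t
      prox_risk_abs[of 1 "\<sigma> * t" \<sigma> \<mu>]
    by (simp add: mixture_risk_def algebra_simps)
  also have "\<dots> < \<sigma>\<^sup>2 * (\<epsilon> * (\<bar>\<mu>\<bar> / \<sigma>)\<^sup>2)"
    using t \<sigma> by simp
  also have "\<dots> = \<epsilon> * \<mu>\<^sup>2"
    using \<sigma> by (simp add: power_divide)
  finally show ?thesis .
qed

subsection \<open>Fixed points of the state evolution\<close>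

text \<open>A fixed point satisfies \<open>\<sigma> * R \<sigma> = \<sigma> * (\<sigma>\<^sup>2 - w\<^sup>2)\<close>, whose
  two sides are monotone, and the right-hand side is continuous and strictly increasing from \<open>0\<close> on
  \<open>{w..}\<close>, so an order-theoretic (Knaster-Tarski) argument applies.\<close>

lemma lowest_fixed_point_exists:
  assumes w: "0 < w" and R_nonneg: "\<And>\<sigma>. 0 \<le> R \<sigma>"
    and R_mono: "\<And>\<sigma> \<sigma>'. 0 < \<sigma> \<Longrightarrow> \<sigma> \<le> \<sigma>' \<Longrightarrow> \<sigma> * R \<sigma> \<le> \<sigma>' * R \<sigma>'"
    and \<Psi>: "\<And>\<sigma>. 0 \<le> \<sigma> \<Longrightarrow> \<Psi> (\<sigma>\<^sup>2) = w\<^sup>2 + R \<sigma>"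
    and B: "0 \<le> B" "w\<^sup>2 + R B \<le> B\<^sup>2"
  obtains \<sigma> where "lowest_fixed_point \<Psi> \<sigma>" "w \<le> \<sigma>" "\<sigma> \<le> B"
proof -
  define k where "k \<sigma> = \<sigma> * (\<sigma>\<^sup>2 - w\<^sup>2)" for \<sigma>
  define S where "S = {\<sigma>. w \<le> \<sigma> \<and> \<sigma> * R \<sigma> \<le> k \<sigma>}"
  define s where "s = Inf S"
  have S_I: "\<sigma> \<in> S" if "0 \<le> \<sigma>" "w\<^sup>2 + R \<sigma> \<le> \<sigma>\<^sup>2" for \<sigma>
  proof -
    have "w\<^sup>2 \<le> \<sigma>\<^sup>2" using that(2) R_nonneg[of \<sigma>] by linarith
    then have "w \<le> \<sigma>" using that(1) by (rule power2_le_imp_le)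
    moreover have "\<sigma> * R \<sigma> \<le> k \<sigma>"
      unfolding k_def using that by (intro mult_left_mono) auto
    ultimately show ?thesis by (simp add: S_def)
  qed
  have BS: "B \<in> S" using S_I B .
  have bdd: "bdd_below S" by (rule bdd_belowI[of _ w]) (simp add: S_def)
  have lower: "s \<le> \<sigma>" if "\<sigma> \<in> S" for \<sigma>
    unfolding s_def using that bdd by (rule cInf_lower)
  have ws: "w \<le> s"
    unfolding s_def using BS by (intro cInf_greatest) (auto simp: S_def)
  \<comment> \<open>\<open>R\<close> need not be continuous. Monotonicity freezes the left side at
    \<open>s\<close>: all members of \<open>S\<close> satisfy
    \<open>s * R s \<le> k \<sigma>\<close>, a closed condition.\<close>
  have "s \<in> {\<sigma>. s * R s \<le> k \<sigma>}"
    unfolding s_def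
  proof (rule closed_subset_contains_Inf)
    show "closed {\<sigma>. Inf S * R (Inf S) \<le> k \<sigma>}"
      unfolding k_def by (intro closed_Collect_le continuous_intros)
    show "S \<subseteq> {\<sigma>. Inf S * R (Inf S) \<le> k \<sigma>}"
      using lower R_mono[of s] w ws by (fastforce simp: S_def s_def)
  qed (use BS bdd in auto)
  then have le: "s * R s \<le> k s" by simp
  moreover have "k w \<le> s * R s"
    using w ws R_nonneg[of s] by (simp add: k_def)
  moreover have "continuous_on {w..s} k"
    unfolding k_def by (intro continuous_intros)
  ultimately obtain t where t: "w \<le> t" "t \<le> s" "k t = s * R s"
    using IVT'[of k w "s * R s" s] ws by auto
  \<comment> \<open>As \<open>t \<le> s\<close>, monotonicity gives
    \<open>t * R t \<le> k t\<close>; minimality of \<open>s\<close> then forces equality at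
    \<open>s\<close>.\<close>
  then have "t \<in> S"
    using R_mono[of t s] w by (simp add: S_def)
  then have "t = s" using lower t(2) by fastforce
  then have "s * R s = s * (s\<^sup>2 - w\<^sup>2)" using t(3) unfolding k_def by metis
  then have "w\<^sup>2 + R s = s\<^sup>2" using w ws by simp
  then have "fixed_point \<Psi> s"
    using \<Psi>[of s] w ws by (simp add: fixed_point_def)
  moreover have "s \<le> \<tau>" if "fixed_point \<Psi> \<tau>" for \<tau>
    using that \<Psi>[of \<tau>] by (intro lower S_I) (auto simp: fixed_point_def)
  ultimately have "lowest_fixed_point \<Psi> s" by (simp add: lowest_fixed_point_def)
  then show ?thesis using ws lower[OF BS] by (rule that)
qed

text \<open>Almost surely the integrand splits into its parts on \<open>X = a\<close> and
  \<open>X = b\<close>; independence factors each part into a point probability and an expectation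
  over \<open>Z\<close>.\<close>

lemma (in prob_space) expectation_two_point_mixture:
  fixes X Z :: "'a \<Rightarrow> real" and f :: "real \<Rightarrow> real \<Rightarrow> real"
  assumes indep: "indep_var borel X borel Z" and "a \<noteq> b"
    and X: "\<And>A. A \<in> sets borel \<Longrightarrow> measure (distr M borel X) A =
             (1 - \<epsilon>) * measure (return borel a) A + \<epsilon> * measure (return borel b) A"
    and f: "f a \<in> borel_measurable borel" "f b \<in> borel_measurable borel"
    and int: "integrable M (\<lambda>\<omega>. f a (Z \<omega>))" "integrable M (\<lambda>\<omega>. f b (Z \<omega>))"
    and meas: "(\<lambda>\<omega>. f (X \<omega>) (Z \<omega>)) \<in> borel_measurable M"
  shows "expectation (\<lambda>\<omega>. f (X \<omega>) (Z \<omega>)) =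
    (1 - \<epsilon>) * expectation (\<lambda>\<omega>. f a (Z \<omega>)) + \<epsilon> * expectation (\<lambda>\<omega>. f b (Z \<omega>))"
proof -
  have [measurable]: "X \<in> borel_measurable M" "Z \<in> borel_measurable M"
    using indep indep_var_rv1 indep_var_rv2 by blast+
  have X_prob: "prob (X -` A \<inter> space M) = (1 - \<epsilon>) * indicator A a + \<epsilon> * indicator A b"
    if "A \<in> sets borel" for A
    using X[OF that] that by (simp add: measure_distr measure_return)
  have X_indicator: "integrable M (\<lambda>\<omega>. indicator {c} (X \<omega>) :: real)"
    "expectation (\<lambda>\<omega>. indicator {c} (X \<omega>) :: real) = (1 - \<epsilon>) * indicator {c} a + \<epsilon> * indicator {c} b" for c
  proof -
    have eq: "(indicator {c} (X \<omega>) :: real) = indicator (X -` {c} \<inter> space M) \<omega>" if "\<omega> \<in> space M" for \<omega>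
      using that by (simp add: indicator_def)
    show "integrable M (\<lambda>\<omega>. indicator {c} (X \<omega>) :: real)"
      by (subst Bochner_Integration.integrable_cong[OF refl eq]) (auto simp: emeasure_eq_measure)
    show "expectation (\<lambda>\<omega>. indicator {c} (X \<omega>) :: real) = (1 - \<epsilon>) * indicator {c} a + \<epsilon> * indicator {c} b"
      using X_prob[of "{c}"] by (subst Bochner_Integration.integral_cong[OF refl eq]) auto
  qed
  have split: "integrable M (\<lambda>\<omega>. indicator {c} (X \<omega>) * f c (Z \<omega>))"
    "expectation (\<lambda>\<omega>. indicator {c} (X \<omega>) * f c (Z \<omega>)) =
      expectation (\<lambda>\<omega>. indicator {c} (X \<omega>)) * expectation (\<lambda>\<omega>. f c (Z \<omega>))"
    if "f c \<in> borel_measurable borel" "integrable M (\<lambda>\<omega>. f c (Z \<omega>))" for c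
  proof -
    have "indep_var borel (\<lambda>\<omega>. indicator {c} (X \<omega>) :: real) borel (\<lambda>\<omega>. f c (Z \<omega>))"
      using indep_var_compose[OF indep, of "indicator {c} :: real \<Rightarrow> real" borel "f c" borel] that(1)
      by (simp add: comp_def)
    from indep_var_integrable[OF this X_indicator(1) that(2)]
      indep_var_lebesgue_integral[OF this X_indicator(1) that(2)]
    show "integrable M (\<lambda>\<omega>. indicator {c} (X \<omega>) * f c (Z \<omega>))"
      "expectation (\<lambda>\<omega>. indicator {c} (X \<omega>) * f c (Z \<omega>)) =
        expectation (\<lambda>\<omega>. indicator {c} (X \<omega>)) * expectation (\<lambda>\<omega>. f c (Z \<omega>))" .
  qed
  have "prob (X -` {a, b} \<inter> space M) = 1"
    using X_prob[of "{a, b}"] by simp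
  then have "AE \<omega> in M. X \<omega> \<in> {a, b}"
    by (subst (asm) AE_in_set_eq_1[symmetric]) (auto elim: eventually_mono)
  then have "AE \<omega> in M. f (X \<omega>) (Z \<omega>) =
      indicator {a} (X \<omega>) * f a (Z \<omega>) + indicator {b} (X \<omega>) * f b (Z \<omega>)"
    by (rule eventually_mono) (use \<open>a \<noteq> b\<close> in auto)
  then have "expectation (\<lambda>\<omega>. f (X \<omega>) (Z \<omega>)) =
      expectation (\<lambda>\<omega>. indicator {a} (X \<omega>) * f a (Z \<omega>) + indicator {b} (X \<omega>) * f b (Z \<omega>))"
    using meas split(1)[OF f(1) int(1)] split(1)[OF f(2) int(2)] by (intro integral_cong_AE) auto
  also have "\<dots> = (1 - \<epsilon>) * expectation (\<lambda>\<omega>. f a (Z \<omega>)) + \<epsilon> * expectation (\<lambda>\<omega>. f b (Z \<omega>))"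
    using \<open>a \<noteq> b\<close> by (simp add: split[OF f(1) int(1)] split[OF f(2) int(2)] X_indicator(2))
  finally show ?thesis .
qed

lemma state_evolution_eq:
  fixes M :: "'a measure" and X Z :: "'a \<Rightarrow> real"
  assumes "prob_space M" "prob_space.indep_var M borel X borel Z" "\<mu> \<noteq> 0"
    and "\<And>A. A \<in> sets borel \<Longrightarrow> measure (distr M borel X) A =
             (1 - \<epsilon>) * measure (return borel 0) A + \<epsilon> * measure (return borel \<mu>) A"
    and Z: "distributed M lborel Z (\<lambda>z. ennreal (std_normal_density z))"
    and p: "0 \<le> p" "p \<le> 1" and "0 \<le> \<sigma>"
  shows "state_evolution M X Z \<delta> w p (\<sigma>\<^sup>2) = w\<^sup>2 + optimal_risk \<epsilon> \<mu> p \<sigma> / \<delta>"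
proof -
  interpret prob_space M by fact
  have [measurable]: "X \<in> borel_measurable M" "Z \<in> borel_measurable M"
    using assms(2) indep_var_rv1 indep_var_rv2 by blast+
  have "(\<integral>\<omega>. \<bar>lp_prox p (X \<omega> + sqrt (\<sigma>\<^sup>2) * Z \<omega>) l - X \<omega>\<bar>\<^sup>2 \<partial>M) = mixture_risk \<epsilon> \<mu> p \<sigma> l"
    if l: "0 \<le> l" for l
  proof -
    define f where "f m z = (lp_prox p (m + \<sigma> * z) l - m)\<^sup>2" for m z
    have f_meas: "f m \<in> borel_measurable borel" for m
      unfolding f_def using borel_measurable_prox_loss[OF p l] by simp
    have f_int: "integrable M (\<lambda>\<omega>. f m (Z \<omega>))"
      and f_exp: "expectation (\<lambda>\<omega>. f m (Z \<omega>)) = prox_risk p \<sigma> l m" for m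
      using distributed_integrable[OF Z, of "f m"] distributed_integral[OF Z, of "f m"] f_meas[of m]
        integrable_prox_loss[OF p l, of m \<sigma>]
      by (simp_all add: prox_risk_def f_def[symmetric])
    note [measurable] = measurable_compose[OF _ borel_measurable_lp_prox[OF p l]]
    have "(\<lambda>\<omega>. f (X \<omega>) (Z \<omega>)) \<in> borel_measurable M"
      unfolding f_def by measurable
    then have "expectation (\<lambda>\<omega>. f (X \<omega>) (Z \<omega>)) = mixture_risk \<epsilon> \<mu> p \<sigma> l"
      using expectation_two_point_mixture[of X Z 0 \<mu> \<epsilon> f] assms(2,3,4) f_meas f_int
      by (simp add: f_exp mixture_risk_def)
    then show ?thesis
      using \<open>0 \<le> \<sigma>\<close> by (simp add: f_def)
  qed
  then show ?thesis
    by (simp add: state_evolution_def optimal_risk_def cong: INF_cong_simp)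
qed

theorem proposition3:
  fixes M :: "'a measure" and X Z :: "'a \<Rightarrow> real" and \<delta> \<epsilon> \<mu> p :: real
  assumes "0 < \<delta>" "\<delta> < 1"
    and "0 < \<epsilon>" "\<epsilon> < 1"
    and "\<mu> \<noteq> 0"
    and "0 \<le> p" "p < 1"
    and "prob_space M"
    and "prob_space.indep_var M borel X borel Z"
    and "\<And>A. A \<in> sets borel \<Longrightarrow>
           measure (distr M borel X) A =
             (1 - \<epsilon>) * measure (return borel 0) A + \<epsilon> * measure (return borel \<mu>) A"
    and "distributed M lborel Z (\<lambda>z. ennreal (std_normal_density z))"
  shows "\<exists>\<sigma>t\<ge>0. \<forall>\<sigma>w>\<sigma>t. \<exists>\<sigma>1 \<sigma>p.
           (\<forall>\<tau>. fixed_point (state_evolution M X Z \<delta> \<sigma>w 1) \<tau> \<longleftrightarrow> \<tau> = \<sigma>1) \<and>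
           lowest_fixed_point (state_evolution M X Z \<delta> \<sigma>w p) \<sigma>p \<and>
           \<sigma>1 < \<sigma>p"
proof -
  \<comment> \<open>From variance \<open>V\<close> on, no threshold beats the zero estimator for
    this \<open>p\<close>.\<close>
  define V where
    "V = (2 * \<bar>\<mu>\<bar> / jump_ratio p)\<^sup>2 + \<epsilon> * \<mu>\<^sup>2 / ((1 - \<epsilon>) * (jump_ratio p)\<^sup>2)"
  define R where "R q \<sigma> = optimal_risk \<epsilon> \<mu> q \<sigma> / \<delta>" for q \<sigma>
  have \<epsilon>: "0 \<le> \<epsilon>" "\<epsilon> \<le> 1" using assms(3,4) by auto
  have V: "0 \<le> V" using assms(3,4) by (simp add: V_def)
  have R_nonneg: "0 \<le> R q \<sigma>" for q \<sigma>
    using optimal_risk_nonneg[OF \<epsilon>] assms(1) by (simp add: R_def)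
  have R_mono: "\<sigma> * R q \<sigma> \<le> \<sigma>' * R q \<sigma>'" if "0 \<le> q" "q \<le> 1" "0 < \<sigma>" "\<sigma> \<le> \<sigma>'" for q \<sigma> \<sigma>'
    using optimal_risk_scaled_mono[OF \<epsilon> that] assms(1) by (simp add: R_def divide_right_mono)
  have \<Psi>: "state_evolution M X Z \<delta> w q (\<sigma>\<^sup>2) = w\<^sup>2 + R q \<sigma>"
    if "0 \<le> q" "q \<le> 1" "0 \<le> \<sigma>" for w q \<sigma>
    unfolding R_def using state_evolution_eq[OF assms(8,9,5,10,11) that] .
  have lowest: "\<exists>\<sigma>. lowest_fixed_point (state_evolution M X Z \<delta> w q) \<sigma> \<and> w \<le> \<sigma> \<and> \<sigma> \<le> B"
    if "0 \<le> q" "q \<le> 1" "0 < w" "0 \<le> B" "w\<^sup>2 + R q B \<le> B\<^sup>2" for q w B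
    by (rule lowest_fixed_point_exists[of w "R q" "state_evolution M X Z \<delta> w q" B])
      (use that R_nonneg R_mono \<Psi> in blast)+
  \<comment> \<open>Noise above \<open>\<bar>\<mu>\<bar>\<close> guarantees the strict gain of soft
    thresholding, noise above \<open>sqrt V\<close> the absence of any gain for
    \<open>p\<close>.\<close>
  have "\<exists>\<sigma>1 \<sigma>p. (\<forall>\<tau>. fixed_point (state_evolution M X Z \<delta> w 1) \<tau> \<longleftrightarrow> \<tau> = \<sigma>1) \<and>
      lowest_fixed_point (state_evolution M X Z \<delta> w p) \<sigma>p \<and> \<sigma>1 < \<sigma>p"
    if w: "max \<bar>\<mu>\<bar> (sqrt V) < w" for w
  proof -
    have w_pos: "0 < w" "\<bar>\<mu>\<bar> < w" "sqrt V < w" using w by auto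
    \<comment> \<open>\<open>R p\<close> never exceeds
      \<open>\<epsilon> * \<mu>\<^sup>2 / \<delta>\<close>, so the map for \<open>p\<close> is at or
      below the diagonal at \<open>B\<close>.\<close>
    define B where "B = sqrt (w\<^sup>2 + \<epsilon> * \<mu>\<^sup>2 / \<delta>)"
    have "w\<^sup>2 + R p B \<le> B\<^sup>2"
      using optimal_risk_nonconvex_le[OF \<epsilon> assms(6,7), of \<mu> B] assms(1) \<epsilon>
      by (simp add: B_def R_def divide_right_mono)
    moreover have "0 \<le> B" using assms(1) \<epsilon> by (simp add: B_def)
    ultimately obtain \<sigma>p where \<sigma>p: "lowest_fixed_point (state_evolution M X Z \<delta> w p) \<sigma>p" "w \<le> \<sigma>p"
      using lowest[of p w B] w_pos assms(6,7) by auto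
    have \<sigma>p_fix: "w\<^sup>2 + R p \<sigma>p = \<sigma>p\<^sup>2"
      using \<sigma>p w_pos \<Psi>[of p \<sigma>p w] assms(6,7)
      by (simp add: lowest_fixed_point_def fixed_point_def)
    have "R 1 \<sigma>p < R p \<sigma>p"
    proof -
      have "(sqrt V)\<^sup>2 \<le> \<sigma>p\<^sup>2"
        using w_pos \<sigma>p V by (intro power_mono) auto
      then have "V \<le> \<sigma>p\<^sup>2" using V by simp
      then have "\<epsilon> * \<mu>\<^sup>2 \<le> optimal_risk \<epsilon> \<mu> p \<sigma>p"
        unfolding V_def using assms(3,4,6,7)
        by (intro optimal_risk_greatest mixture_risk_nonconvex_ge) auto
      moreover have "optimal_risk \<epsilon> \<mu> 1 \<sigma>p < \<epsilon> * \<mu>\<^sup>2"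
        using assms(3-5) w_pos \<sigma>p by (intro optimal_risk_1_less) auto
      ultimately show ?thesis
        using assms(1) by (simp add: R_def divide_strict_right_mono)
    qed
    \<comment> \<open>This makes \<open>\<sigma>p\<close> an upper bound for the lowest fixed point
      of the soft map, and strictness later excludes equality.\<close>
    then have less: "w\<^sup>2 + R 1 \<sigma>p < \<sigma>p\<^sup>2" using \<sigma>p_fix by linarith
    then obtain \<sigma>1 where \<sigma>1: "lowest_fixed_point (state_evolution M X Z \<delta> w 1) \<sigma>1" "\<sigma>1 \<le> \<sigma>p"
      using lowest[of 1 w \<sigma>p] \<sigma>p(2) w_pos by auto
    have fix1: "fixed_point (state_evolution M X Z \<delta> w 1) \<tau> \<longleftrightarrow> 0 \<le> \<tau> \<and> w\<^sup>2 + R 1 \<tau> = \<tau>\<^sup>2" for \<tau>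
      using \<Psi>[of 1 \<tau> w] by (auto simp: fixed_point_def)
    \<comment> \<open>After division by \<open>\<sigma>\<^sup>2\<close> the equation reads
      \<open>w\<^sup>2 / \<sigma>\<^sup>2 + R 1 \<sigma> / \<sigma>\<^sup>2 = 1\<close>, with a
      strictly decreasing and a nonincreasing summand.\<close>
    have ratio: "\<not> \<sigma> < \<tau>" if "0 \<le> \<sigma>" "w\<^sup>2 + R 1 \<sigma> = \<sigma>\<^sup>2" "w\<^sup>2 + R 1 \<tau> = \<tau>\<^sup>2" for \<sigma> \<tau>
    proof
      assume "\<sigma> < \<tau>"
      have "0 < \<sigma>\<^sup>2" using that(2) R_nonneg[of 1 \<sigma>] w_pos by (metis add_pos_nonneg zero_less_power)
      then have \<sigma>: "0 < \<sigma>" "0 < \<tau>" using that(1) \<open>\<sigma> < \<tau>\<close> by auto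
      have "w\<^sup>2 / \<tau>\<^sup>2 < w\<^sup>2 / \<sigma>\<^sup>2"
        using \<sigma> \<open>\<sigma> < \<tau>\<close> w_pos by (intro divide_strict_left_mono power_strict_mono) auto
      moreover have "R 1 \<tau> / \<tau>\<^sup>2 \<le> R 1 \<sigma> / \<sigma>\<^sup>2"
        using divide_right_mono[OF optimal_risk_1_ratio_antimono[OF \<epsilon> \<sigma>(1), of \<tau> \<mu>], of \<delta>]
          \<open>\<sigma> < \<tau>\<close> assms(1)
        by (simp add: R_def mult.commute)
      ultimately have "(w\<^sup>2 + R 1 \<tau>) / \<tau>\<^sup>2 < (w\<^sup>2 + R 1 \<sigma>) / \<sigma>\<^sup>2"
        by (simp add: add_divide_distrib)
      then show False using that \<sigma> by simp
    qed
    have \<sigma>1_fix: "0 \<le> \<sigma>1 \<and> w\<^sup>2 + R 1 \<sigma>1 = \<sigma>1\<^sup>2"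
      using \<sigma>1(1) fix1 by (simp add: lowest_fixed_point_def)
    then have "\<sigma>1 < \<sigma>p" using \<sigma>1(2) less by (cases "\<sigma>1 = \<sigma>p") auto
    moreover have "fixed_point (state_evolution M X Z \<delta> w 1) \<tau> \<longleftrightarrow> \<tau> = \<sigma>1" for \<tau>
      using fix1 \<sigma>1_fix ratio by (metis linorder_neqE)
    ultimately show ?thesis using \<sigma>p(1) by blast
  qed
  then show ?thesis
    by (intro exI[of _ "max \<bar>\<mu>\<bar> (sqrt V)"]) auto
qed

end
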